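(* Let $\alpha>-1$ and $1<p<\infty$, and let $q=\frac{p}{p-1}$ be the conjugate exponent of $p$. Then the operator norm $\|P_\alpha\|_{p,\alpha}$ of the Bergman projection $P_\alpha$ on $L^p_\alpha(\mathbb{D})$ satisfies $$\frac{\Gamma\left(\frac{2+\alpha}{p}\right)\Gamma\left(\frac{2+\alpha}{q}\right)}{\Gamma^2\left(\frac{2+\alpha}{2}\right)}\;\leq\;\|P_\alpha\|_{p,\alpha}\;\leq\;(1+\alpha)\,\frac{\Gamma\left(\frac{1+\alpha}{p}\right)\Gamma\left(\frac{1+\alpha}{q}\right)}{\Gamma^2\left(\frac{2+\alpha}{2}\right)}.$$
   Context: $\mathbb{D}$ is the open unit disk in $\mathbb{C}$ and $dA(z)=\pi^{-1}dx\,dy$ is normalized Lebesgue area measure. For $\alpha>-1$, $dA_\alpha(z)=(1+\alpha)(1-|z|^2)^\alpha dA(z)$, a probability measure on $\mathbb{D}$. $L^p_\alpha(\mathbb{D})$ is the space of (complex-valued) Lebesgue measurable functions $f$ on $\mathbb{D}$ with $\|f\|_{p,\alpha}:=\left(\int_{\mathbb{D}}|f|^p\,dA_\alpha\right)^{1/p}<\infty$. The Bergman projection is the integral operator $$P_\alpha f(z)=\int_{\mathbb{D}}\frac{f(w)}{(1-z\bar w)^{2+\alpha}}\,dA_\alpha(w),\qquad z\in\mathbb{D},$$ with principal branch of the power, and $$\|P_\alpha\|_{p,\alpha}:=\sup\left\{\frac{\|P_\alpha f\|_{p,\alpha}}{\|f\|_{p,\alpha}}:\ f\in L^p_\alpha(\mathbb{D}),\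 f\neq0\right\}.$$ $\Gamma$ is the Gamma function and $\Gamma^2(x)=\Gamma(x)^2$. *)

theory Defs
  imports "HOL-Analysis.Analysis"
begin

abbreviation unit_disk :: "complex set" where
  "unit_disk \<equiv> ball 0 1"

definition disk_area :: "complex measure" where
  "disk_area = scale_measure (ennreal (1 / pi)) (lebesgue_on unit_disk)"

definition weighted_area :: "real \<Rightarrow> complex measure" where
  "weighted_area \<alpha> =
     density disk_area (\<lambda>z. ennreal ((1 + \<alpha>) * (1 - (cmod z)\<^sup>2) powr \<alpha>))"

text \<open>
  The norm is taken in \<^typ>\<open>ennreal\<close>, so that it is \<^term>\<open>\<infinity>\<close> rather than a
  default value on functions outside the space. As there is no real power on
  \<^typ>\<open>ennreal\<close>, the infinite case is split off before taking the root.
\<close>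

definition bergman_norm :: "real \<Rightarrow> real \<Rightarrow> (complex \<Rightarrow> complex) \<Rightarrow> ennreal" where
  "bergman_norm p \<alpha> f =
     (let I = (\<integral>\<^sup>+ z. ennreal (cmod (f z) powr p) \<partial>weighted_area \<alpha>)
      in if I = \<infinity> then \<infinity> else ennreal (enn2real I powr (1 / p)))"

definition weighted_Lp :: "real \<Rightarrow> real \<Rightarrow> (complex \<Rightarrow> complex) set" where
  "weighted_Lp p \<alpha> =
     {f \<in> borel_measurable (lebesgue_on unit_disk). bergman_norm p \<alpha> f < \<infinity>}"

definition bergman_projection :: "real \<Rightarrow> (complex \<Rightarrow> complex) \<Rightarrow> complex \<Rightarrow> complex" where
  "bergman_projection \<alpha> f z =
     (LINT w | weighted_area \<alpha>. f w / (1 - z * cnj w) powr complex_of_real (2 + \<alpha>))"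

text \<open>
  Elements of \<^const>\<open>weighted_Lp\<close> are functions, not classes modulo null sets,
  so being nonzero means not vanishing almost everywhere. The values of the
  functions outside the disk are irrelevant.
\<close>

definition bergman_projection_norm :: "real \<Rightarrow> real \<Rightarrow> ennreal" where
  "bergman_projection_norm p \<alpha> =
     (SUP f \<in> {f \<in> weighted_Lp p \<alpha>. \<not> (AE z in weighted_area \<alpha>. f z = 0)}.
        bergman_norm p \<alpha> (bergman_projection \<alpha> f) / bergman_norm p \<alpha> f)"

end

theory Submission
  imports Defs "HOL-Complex_Analysis.Complex_Analysis"
begin

text \<open>
  Write \<open>c = 2 + \<alpha>\<close>.

  Upper bound: Schur's test with the weight \<open>(1-|w|\<^sup>2)\<^bsup>-(1+\<alpha>)/(pq)\<^esup>\<close>. It needs the sharp estimate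
  of \<open>\<integral>(1-|w|\<^sup>2)\<^bsup>t\<^esup>|1-zw\<^sup>*|\<^bsup>-(2+t+d)\<^esup>\<close> by a multiple of \<open>(1-|z|\<^sup>2)\<^bsup>-d\<^esup>\<close>, which holds coefficient by
  coefficient in powers of \<open>|z|\<^sup>2\<close> because \<open>\<Gamma>\<close> is log-convex.

  Lower bound: test on \<open>f(w) = (1-w)\<^bsup>-c/2\<^esup>(1-w\<^sup>*)\<^bsup>c/2-s\<^esup>\<close> with \<open>s\<close> increasing to \<open>c/p\<close>. Here
  \<open>|f| = |1-w|\<^bsup>-s\<^esup>\<close>, and \<open>P f(z)\<close> is a multiple of \<open>\<integral>\<^sub>0\<^sup>1 t\<^bsup>c/2-1\<^esup>(1-t)\<^bsup>c-s-1\<^esup>(1-tz)\<^bsup>-c\<^esup> dt\<close>. With \<open>t\<^bsup>s-1\<^esup>\<close> in place of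
  \<open>t\<^bsup>c/2-1\<^esup>\<close> this would be exactly \<open>B(s,c-s)(1-z)\<^bsup>-s\<^esup>\<close>, and the difference stays bounded in
  \<open>L\<^sup>p\<close> while \<open>\<parallel>f\<parallel>\<close> tends to infinity. So the norm is at least
  \<open>\<Gamma>(s)\<Gamma>(c-s)/\<Gamma>(c/2)\<^sup>2\<close> in the limit \<open>s = c/p\<close>. The first exponent \<open>c/2\<close> is the optimal one.
\<close>

section \<open>Invariance and radial integration on the disk\<close>

text \<open>The Schur weight is chosen for symmetry. Its p-th and q-th powers have exponents
  \<open>-(1+\<alpha>)/q\<close> and \<open>-(1+\<alpha>)/p\<close>, whose absolute values add up to
  1+\<alpha>. The kernel estimate at exponent d has a constant proportional to \<Gamma>(d)
  \<Gamma>(1+\<alpha>-d), so both integrals of the test share one constant.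

  The critical exponent c/p is where |1-w|^(-sp) stops being integrable, which is why the norm of f
  diverges there. With a general holomorphic exponent a in place of c/2 the limiting quotient is
  B(s,c-s)/B(a,c-a); by log-convexity \<Gamma>(a) \<Gamma>(c-a) is smallest at a = c/2.

  The obstacle is that all explicit integrals are evaluated through power series, whose absolute
  convergence may fail at the boundary point 1 where f is singular. The disk integrals are therefore
  computed with 1 - rw in place of 1 - w for r < 1, and every passage r \<rightarrow> 1 needs a
  bound uniform in r.\<close>

lemma ball_borel [measurable]: "ball (x::'a::euclidean_space) r \<in> sets borel"
  by simp

lemma borel_measurable_cnj [measurable (raw)]:
  "f \<in> borel_measurable M \<Longrightarrow> (\<lambda>x. cnj (f x)) \<in> borel_measurable M"
  by (rule measurable_compose[OF _ borel_measurable_continuous_onI[OF continuous_on_cnj[OF continuous_on_id]]])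

lemma nn_integral_lborel_translate:
  fixes f :: "'a::euclidean_space \<Rightarrow> ennreal"
  assumes [measurable]: "f \<in> borel_measurable borel"
  shows "(\<integral>\<^sup>+ x. f (t + x) \<partial>lborel) = (\<integral>\<^sup>+ x. f x \<partial>lborel)"
proof -
  have "(\<integral>\<^sup>+ x. f x \<partial>lborel) = (\<integral>\<^sup>+ x. f x \<partial>distr lborel borel ((+) t))"
    by (simp add: lborel_distr_plus)
  also have "\<dots> = (\<integral>\<^sup>+ x. f (t + x) \<partial>lborel)"
    by (subst nn_integral_distr) auto
  finally show ?thesis by simp
qed

text \<open>
  Rotation invariance comes from the uniqueness argument for Haar measure: integrate
  \<open>f(\<omega>x) 1\<^sub>B(\<omega>x - y)\<close> over both variables, where \<open>B\<close> is the unit disk, and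
  evaluate in either order using translation invariance only.
\<close>

lemma nn_integral_lborel_rotate:
  fixes f :: "complex \<Rightarrow> ennreal"
  assumes [measurable]: "f \<in> borel_measurable borel" and w: "cmod w = 1"
  shows "(\<integral>\<^sup>+ z. f (w * z) \<partial>lborel) = (\<integral>\<^sup>+ z. f z \<partial>lborel)"
proof -
  define B where "B = (indicator (ball 0 1) :: complex \<Rightarrow> ennreal)"
  have [measurable]: "B \<in> borel_measurable borel" by (simp add: B_def)
  have B_minus: "B (- z) = B z" and B_rot: "B (w * z) = B z" for z
    using w by (simp_all add: B_def indicator_def norm_mult)
  define m where "m = (\<integral>\<^sup>+ z. B z \<partial>lborel)"
  have "m = ennreal pi"
    by (simp add: m_def B_def emeasure_ball unit_ball_vol_2)
  then have m: "m \<noteq> 0" "m \<noteq> \<infinity>" by auto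
  have w0: "w \<noteq> 0" using w by auto
  have "(\<integral>\<^sup>+ x. f (w * x) \<partial>lborel) * m = (\<integral>\<^sup>+ x. f (w * x) * m \<partial>lborel)"
    by (rule nn_integral_multc[symmetric]) auto
  also have "\<dots> = (\<integral>\<^sup>+ x. (\<integral>\<^sup>+ y. f (w * x) * B (w * x - y) \<partial>lborel) \<partial>lborel)"
  proof (rule nn_integral_cong)
    fix x
    have "(\<integral>\<^sup>+ y. B (w * x - y) \<partial>lborel) = m"
      using nn_integral_lborel_translate[of B "- (w * x)"] B_minus[of "w * x - y" for y]
      by (simp add: m_def)
    then show "f (w * x) * m = (\<integral>\<^sup>+ y. f (w * x) * B (w * x - y) \<partial>lborel)"
      by (simp add: nn_integral_cmult)
  qed
  also have "\<dots> = (\<integral>\<^sup>+ y. (\<integral>\<^sup>+ x. f (w * x) * B (w * x - y) \<partial>lborel) \<partial>lborel)"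
    by (rule lborel_pair.Fubini'[symmetric]) simp
  \<comment> \<open>Shifting x by \<open>y / w\<close> turns \<open>w * x\<close> into
    \<open>w * x + y\<close>; then \<open>B\<close> sees only \<open>w * x\<close>, and its own
    rotation invariance removes \<open>w\<close>.\<close>
  also have "\<dots> = (\<integral>\<^sup>+ y. (\<integral>\<^sup>+ x. f (w * x + y) * B x \<partial>lborel) \<partial>lborel)"
  proof (rule nn_integral_cong)
    fix y
    show "(\<integral>\<^sup>+ x. f (w * x) * B (w * x - y) \<partial>lborel) = (\<integral>\<^sup>+ x. f (w * x + y) * B x \<partial>lborel)"
      using nn_integral_lborel_translate[of "\<lambda>x. f (w * x) * B (w * x - y)" "y / w"] w0
      by (simp add: ring_distribs B_rot add.commute)
  qed
  also have "\<dots> = (\<integral>\<^sup>+ x. (\<integral>\<^sup>+ y. f (w * x + y) * B x \<partial>lborel) \<partial>lborel)"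
    by (rule lborel_pair.Fubini') simp
  also have "\<dots> = (\<integral>\<^sup>+ x. (\<integral>\<^sup>+ y. f y \<partial>lborel) * B x \<partial>lborel)"
    using nn_integral_lborel_translate[of f]
    by (intro nn_integral_cong) (simp add: nn_integral_multc)
  also have "\<dots> = (\<integral>\<^sup>+ y. f y \<partial>lborel) * m"
    by (simp add: nn_integral_cmult m_def)
  finally show ?thesis
    using m ennreal_mult_cancel_left[of m] by (simp add: mult.commute[of _ m])
qed

section \<open>Integration against the weighted area measure\<close>

lemma sets_weighted_area [simp, measurable_cong]:
  "sets (weighted_area \<alpha>) = sets (lebesgue_on unit_disk)"
  by (simp add: weighted_area_def disk_area_def)

lemma space_weighted_area [simp]: "space (weighted_area \<alpha>) = unit_disk"
  by (simp add: weighted_area_def disk_area_def space_scale_measure)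

lemma borel_measurable_lebesgue_on_disk:
  "f \<in> borel_measurable borel \<Longrightarrow> f \<in> borel_measurable (lebesgue_on unit_disk)"
  by (intro measurable_restrict_space1 measurable_completion) simp

lemma measurable_weighted_area_id [measurable]: "(\<lambda>z. z) \<in> weighted_area \<alpha> \<rightarrow>\<^sub>M borel"
  using borel_measurable_lebesgue_on_disk[of "\<lambda>z. z"]
  by (simp cong: measurable_cong_sets)

lemma nn_integral_disk_area:
  assumes [measurable]: "f \<in> borel_measurable borel"
  shows "(\<integral>\<^sup>+ z. f z \<partial>disk_area) =
    ennreal (1 / pi) * (\<integral>\<^sup>+ z. f z * indicator unit_disk z \<partial>lborel)"
proof -
  have "(\<integral>\<^sup>+ z. f z \<partial>disk_area) = ennreal (1 / pi) * (\<integral>\<^sup>+ z. f z \<partial>lebesgue_on unit_disk)"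
    unfolding disk_area_def
    by (rule nn_integral_scale_measure) (rule borel_measurable_lebesgue_on_disk, simp)
  also have "(\<integral>\<^sup>+ z. f z \<partial>lebesgue_on unit_disk) = (\<integral>\<^sup>+ z. f z * indicator unit_disk z \<partial>lebesgue)"
    by (rule nn_integral_restrict_space) simp
  also have "\<dots> = (\<integral>\<^sup>+ z. f z * indicator unit_disk z \<partial>lborel)"
    by (rule nn_integral_completion)
  finally show ?thesis .
qed

lemma nn_integral_weighted_area:
  assumes [measurable]: "f \<in> borel_measurable borel"
  shows "(\<integral>\<^sup>+ z. f z \<partial>weighted_area \<alpha>) =
    (\<integral>\<^sup>+ z. ennreal ((1 + \<alpha>) * (1 - (cmod z)\<^sup>2) powr \<alpha>) * f z \<partial>disk_area)"
  unfolding weighted_area_def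
  by (rule nn_integral_density)
     (auto simp: disk_area_def intro!: borel_measurable_lebesgue_on_disk cong: measurable_cong_sets)

lemma nn_integral_weighted_area_rotate:
  assumes [measurable]: "f \<in> borel_measurable borel" and w: "cmod w = 1"
  shows "(\<integral>\<^sup>+ z. f (w * z) \<partial>weighted_area \<alpha>) = (\<integral>\<^sup>+ z. f z \<partial>weighted_area \<alpha>)"
proof -
  have [simp]: "indicator unit_disk (w * z) = (indicator unit_disk z :: ennreal)" for z
    using w by (simp add: indicator_def norm_mult)
  define g where "g z = ennreal ((1 + \<alpha>) * (1 - (cmod z)\<^sup>2) powr \<alpha>) * f z * indicator unit_disk z" for z
  have [measurable]: "g \<in> borel_measurable borel" unfolding g_def by measurable
  have "(\<integral>\<^sup>+ z. f (w * z) \<partial>weighted_area \<alpha>) = ennreal (1 / pi) * (\<integral>\<^sup>+ z. g (w * z) \<partial>lborel)"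
    using w by (simp add: nn_integral_weighted_area nn_integral_disk_area norm_mult g_def)
  also have "\<dots> = ennreal (1 / pi) * (\<integral>\<^sup>+ z. g z \<partial>lborel)"
    using w by (simp add: nn_integral_lborel_rotate)
  also have "\<dots> = (\<integral>\<^sup>+ z. f z \<partial>weighted_area \<alpha>)"
    by (simp add: nn_integral_weighted_area nn_integral_disk_area g_def)
  finally show ?thesis .
qed

text \<open>Equality of push-forwards on Borel sets carries over to Bochner integrals, whether or
  not \<open>f\<close> is integrable. The multiplier 1 represents the unrotated side.\<close>

lemma integral_weighted_area_rotate:
  fixes f :: "complex \<Rightarrow> complex"
  assumes [measurable]: "f \<in> borel_measurable borel" and w: "cmod w = 1"
  shows "(LINT z | weighted_area \<alpha>. f (w * z)) = (LINT z | weighted_area \<alpha>. f z)"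
proof -
  have "distr (weighted_area \<alpha>) borel (\<lambda>z. w * z) = distr (weighted_area \<alpha>) borel (\<lambda>z. z)"
  proof (rule measure_eqI)
    fix A assume "A \<in> sets (distr (weighted_area \<alpha>) borel (\<lambda>z. w * z))"
    then have [measurable]: "A \<in> sets borel" by simp
    have "emeasure (distr (weighted_area \<alpha>) borel ((*) v)) A =
        (\<integral>\<^sup>+ z. indicator A (v * z) \<partial>weighted_area \<alpha>)" for v
      by (subst nn_integral_distr[symmetric, where f = "indicator A" and T = "(*) v" and M' = borel]) auto
    from this[of w] this[of 1]
    have "emeasure (distr (weighted_area \<alpha>) borel ((*) w)) A =
        emeasure (distr (weighted_area \<alpha>) borel ((*) 1)) A"
      using nn_integral_weighted_area_rotate[of "indicator A" w \<alpha>] w by simp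
    moreover have "(*) 1 = (\<lambda>z::complex. z)" by auto
    ultimately show "emeasure (distr (weighted_area \<alpha>) borel ((*) w)) A =
        emeasure (distr (weighted_area \<alpha>) borel (\<lambda>z. z)) A" by simp
  qed simp
  moreover have "(LINT z | weighted_area \<alpha>. f (v * z)) =
      (LINT z | distr (weighted_area \<alpha>) borel (\<lambda>z. v * z). f z)" for v
    by (rule integral_distr[symmetric]) auto
  from this[of w] this[of 1] show ?thesis using calculation by simp
qed

text \<open>Under normalized area, |z|^2 is uniformly distributed on (0,1): for x in that interval,
  the set |z|^2 > x is an annulus of normalized area 1 - x. Half-lines determine the push-forward,
  so no polar coordinates are involved.\<close>

lemma nn_integral_disk_area_radial:
  fixes f :: "real \<Rightarrow> ennreal"
  assumes [measurable]: "f \<in> borel_measurable borel"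
  shows "(\<integral>\<^sup>+ z. f ((cmod z)\<^sup>2) \<partial>disk_area) = (\<integral>\<^sup>+ x. f x * indicator {0<..<1} x \<partial>lborel)"
proof -
  have [measurable]: "(\<lambda>z. (cmod z)\<^sup>2) \<in> disk_area \<rightarrow>\<^sub>M borel"
    by (auto simp: disk_area_def intro!: borel_measurable_lebesgue_on_disk cong: measurable_cong_sets)
  have em: "emeasure (distr disk_area borel (\<lambda>z. (cmod z)\<^sup>2)) {x<..} = 
      emeasure (density lborel (indicator {0<..<1::real})) {x<..}" for x
  proof -
    have "emeasure (distr disk_area borel (\<lambda>z. (cmod z)\<^sup>2)) {x<..} =
        (\<integral>\<^sup>+ z. indicator {x<..} ((cmod z)\<^sup>2) \<partial>disk_area)"
      by (subst nn_integral_distr[symmetric, where f = "indicator {x<..}" and M' = borel]) auto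
    also have "\<dots> = ennreal (1 / pi) *
        (\<integral>\<^sup>+ z. indicator {x<..} ((cmod z)\<^sup>2) * indicator unit_disk z \<partial>lborel)"
      by (rule nn_integral_disk_area) auto
    also have "(\<integral>\<^sup>+ z. indicator {x<..} ((cmod z)\<^sup>2) * indicator unit_disk z \<partial>lborel) =
        ennreal (pi * (1 - min 1 (max 0 x)))"
    proof (cases "x < 0")
      case True
      then have "(\<lambda>z. indicator {x<..} ((cmod z)\<^sup>2) * indicator unit_disk z) =
         (indicator unit_disk :: complex \<Rightarrow> ennreal)"
        by (auto simp: indicator_def fun_eq_iff intro: less_le_trans)
      with True show ?thesis by (simp add: emeasure_ball unit_ball_vol_2)
    next
      case False
      \<comment> \<open>The cap at 1 makes the annulus empty once x \<ge> 1.\<close>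
      define r where "r = min 1 (sqrt x)"
      have r: "0 \<le> r" "r \<le> 1" "r\<^sup>2 = min 1 x"
        using False by (auto simp: r_def min_def)
      have sqrt_less: "x < (cmod z)\<^sup>2 \<longleftrightarrow> sqrt x < cmod z" for z
        using False by (metis norm_ge_zero real_sqrt_abs real_sqrt_less_iff abs_norm_cancel)
      have "(\<lambda>z. indicator {x<..} ((cmod z)\<^sup>2) * indicator unit_disk z) =
         (indicator (unit_disk - cball 0 r) :: complex \<Rightarrow> ennreal)"
      proof
        fix z :: complex
        have "x < (cmod z)\<^sup>2 \<and> cmod z < 1 \<longleftrightarrow> cmod z < 1 \<and> \<not> cmod z \<le> r"
          unfolding sqrt_less r_def by linarith
        then show "indicator {x<..} ((cmod z)\<^sup>2) * indicator unit_disk z =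
            (indicator (unit_disk - cball 0 r) z :: ennreal)"
          by (auto simp: indicator_def)
      qed
      then have "(\<integral>\<^sup>+ z. indicator {x<..} ((cmod z)\<^sup>2) * indicator unit_disk z \<partial>lborel) =
          emeasure lborel (unit_disk - cball (0::complex) r)"
        by simp
      also have "\<dots> = emeasure lborel (unit_disk - ball (0::complex) r)"
      proof (rule emeasure_eq_AE)
        have "sphere (0::complex) r \<in> null_sets lborel"
          using negligible_sphere[of "0::complex" r]
          by (simp add: negligible_iff_null_sets null_sets_completion_iff)
        then have "AE z in lborel. z \<notin> sphere (0::complex) r"
          by (rule AE_not_in)
        then show "AE z in lborel. z \<in> unit_disk - cball 0 r \<longleftrightarrow> z \<in> unit_disk - ball (0::complex) r"
          by eventually_elim auto
      qed auto
      also have "\<dots> = emeasure lborel (unit_disk::complex set) - emeasure lborel (ball (0::complex) r)"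
        using r by (intro emeasure_Diff) (auto simp: emeasure_ball)
      also have "\<dots> = ennreal (pi - pi * r\<^sup>2)"
        using r(1) by (simp add: emeasure_ball unit_ball_vol_2 ennreal_minus)
      finally show ?thesis using False r by (simp add: ring_distribs min_def)
    qed
    also have "ennreal (1 / pi) * \<dots> = ennreal (1 - min 1 (max 0 x))"
      by (simp add: ennreal_mult[symmetric])
    also have "\<dots> = emeasure lborel ({0<..<1} \<inter> {x<..})"
    proof -
      have "{0<..<1} \<inter> {x<..} = {max 0 x<..<1}" by auto
      then show ?thesis by (auto simp: min_def)
    qed
    also have "\<dots> = (\<integral>\<^sup>+ y. indicator ({0<..<1} \<inter> {x<..}) y \<partial>lborel)"
      by simp
    also have "\<dots> = emeasure (density lborel (indicator {0<..<1::real})) {x<..}"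
      by (subst emeasure_density) (auto intro!: nn_integral_cong split: split_indicator simp del: nn_integral_indicator)
    finally show ?thesis .
  qed
  have "distr disk_area borel (\<lambda>z. (cmod z)\<^sup>2) = density lborel (indicator {0<..<1})"
  proof (rule measure_eqI_lessThan)
    show "emeasure (distr disk_area borel (\<lambda>z. (cmod z)\<^sup>2)) {x<..} < \<infinity>" for x
    proof -
      have "emeasure (density lborel (indicator {0<..<1::real})) {x<..} \<le>
          (\<integral>\<^sup>+ x. indicator {0<..<1::real} x \<partial>lborel)"
        by (subst emeasure_density)
           (auto intro!: nn_integral_mono split: split_indicator simp del: nn_integral_indicator)
      also have "\<dots> < \<infinity>" by simp
      finally show ?thesis by (simp add: em)
    qed
  qed (simp_all add: em)
  then have "(\<integral>\<^sup>+ x. f x \<partial>distr disk_area borel (\<lambda>z. (cmod z)\<^sup>2)) =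
      (\<integral>\<^sup>+ x. f x \<partial>density lborel (indicator {0<..<1}))" by simp
  then show ?thesis
    by (simp add: nn_integral_distr nn_integral_density mult.commute)
qed

section \<open>Beta measures and power series on the disk\<close>

text \<open>Left unnormalized, so that multiplication by powers of t and 1 - t merely shifts the two
  parameters.\<close>

definition beta_measure :: "real \<Rightarrow> real \<Rightarrow> real measure" where
  "beta_measure a b =
     density lborel (\<lambda>t. ennreal (indicator {0<..<1} t * (t powr (a - 1) * (1 - t) powr (b - 1))))"

lemma sets_beta_measure [simp, measurable_cong]: "sets (beta_measure a b) = sets borel"
  and space_beta_measure [simp]: "space (beta_measure a b) = UNIV"
  by (simp_all add: beta_measure_def)

lemma AE_beta_measure: "AE t in beta_measure a b. t \<in> {0<..<1}"
  unfolding beta_measure_def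
  by (subst AE_density) (auto intro!: AE_I2 simp: indicator_def split: if_splits)

lemma emeasure_beta_measure:
  assumes "a > 0" "b > 0"
  shows "emeasure (beta_measure a b) UNIV = ennreal (Beta a b)"
proof -
  have "((\<lambda>t. t powr (a - 1) * (1 - t) powr (b - 1)) has_integral Beta a b) {0<..<1}"
    using has_integral_Beta_real[OF assms] by (simp add: has_integral_Icc_iff_Ioo)
  then have "((\<lambda>t. indicator {0<..<1} t * (t powr (a - 1) * (1 - t) powr (b - 1))) has_integral Beta a b) UNIV"
    by (subst (asm) has_integral_restrict_UNIV[symmetric])
       (auto elim!: has_integral_eq_rhs has_integral_eq[rotated] simp: indicator_def)
  then show ?thesis
    unfolding beta_measure_def
    by (subst emeasure_density) (auto intro!: nn_integral_has_integral_lborel)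
qed

lemma Beta_real_pos: "a > 0 \<Longrightarrow> b > 0 \<Longrightarrow> Beta a b > (0::real)"
  by (simp add: Beta_def)

lemma pos_not_nonpos_Ints: "(x::real) > 0 \<Longrightarrow> x \<notin> \<int>\<^sub>\<le>\<^sub>0"
  by (auto elim!: nonpos_Ints_cases)

lemma Beta_real_1_left: "b > 0 \<Longrightarrow> b * Beta 1 b = (1::real)"
  using Gamma_plus1[of b] Gamma_real_pos[of b] pos_not_nonpos_Ints[of b]
  by (simp add: Beta_def add.commute Gamma_eq_zero_iff)

lemma finite_measure_beta_measure: "a > 0 \<Longrightarrow> b > 0 \<Longrightarrow> finite_measure (beta_measure a b)"
  by (rule finite_measureI) (simp add: emeasure_beta_measure)

lemma measure_beta_measure: "a > 0 \<Longrightarrow> b > 0 \<Longrightarrow> measure (beta_measure a b) UNIV = Beta a b"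
  by (simp add: measure_def emeasure_beta_measure Beta_real_pos less_imp_le)

text \<open>Both sides are the same Lebesgue integral, with the extra powers merged into the
  density. The parameters may thus be arbitrary reals, and powers of t and 1 - t can be moved
  between integrand and measure at will.\<close>

lemma
  fixes f :: "real \<Rightarrow> 'a::{banach, second_countable_topology}"
  assumes [measurable]: "f \<in> borel_measurable borel"
  shows integral_beta_measure_tilt:
    "(LINT t | beta_measure a b. (t powr x * (1 - t) powr y) *\<^sub>R f t) =
      (LINT t | beta_measure (a + x) (b + y). f t)"
    and integrable_beta_measure_tilt:
    "integrable (beta_measure a b) (\<lambda>t. (t powr x * (1 - t) powr y) *\<^sub>R f t) \<longleftrightarrow>
      integrable (beta_measure (a + x) (b + y)) f"
proof -
  have *: "(indicator {0<..<1} t * (t powr (a - 1) * (1 - t) powr (b - 1))) *\<^sub>R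
      ((t powr x * (1 - t) powr y) *\<^sub>R f t) =
      (indicator {0<..<1} t * (t powr (a + x - 1) * (1 - t) powr (b + y - 1))) *\<^sub>R f t" for t
    by (auto simp: indicator_def powr_add[symmetric] algebra_simps)
  show "(LINT t | beta_measure a b. (t powr x * (1 - t) powr y) *\<^sub>R f t) =
      (LINT t | beta_measure (a + x) (b + y). f t)"
    unfolding beta_measure_def
    by (subst (1 2) integral_density) (auto simp: * simp del: scaleR_scaleR)
  show "integrable (beta_measure a b) (\<lambda>t. (t powr x * (1 - t) powr y) *\<^sub>R f t) \<longleftrightarrow>
      integrable (beta_measure (a + x) (b + y)) f"
    unfolding beta_measure_def
    by (subst (1 2) integrable_density) (auto simp: * simp del: scaleR_scaleR)
qed

text \<open>Weierstrass' M-test: constants are integrable on a finite measure space, so summable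
  bounds dominate both the series and the integrals of its terms.\<close>

lemma (in finite_measure) sums_integral_uniformly_bounded:
  fixes f :: "nat \<Rightarrow> 'a \<Rightarrow> 'b::{banach, second_countable_topology}"
  assumes [measurable]: "\<And>i. f i \<in> borel_measurable M"
    and le: "\<And>i. AE x in M. norm (f i x) \<le> c i" and c: "summable c"
  shows "(\<lambda>i. LINT x | M. f i x) sums (LINT x | M. (\<Sum>i. f i x))"
proof (rule sums_integral)
  show int: "integrable M (f i)" for i
    by (rule integrable_const_bound[OF le]) simp
  have "AE x in M. \<forall>i. norm (f i x) \<le> c i"
    using le by (simp add: AE_all_countable)
  then show "AE x in M. summable (\<lambda>i. norm (f i x))"
    by eventually_elim (auto intro: summable_comparison_test'[OF c])
  show "summable (\<lambda>i. LINT x | M. norm (f i x))"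
  proof (rule summable_comparison_test')
    show "summable (\<lambda>i. c i * measure M (space M))"
      by (rule summable_mult2[OF c])
    fix i
    have "(LINT x | M. norm (f i x)) \<le> (LINT x | M. c i)"
      using int le by (intro integral_mono_AE) auto
    then show "norm (LINT x | M. norm (f i x)) \<le> c i * measure M (space M)"
      by (simp add: integral_nonneg mult.commute)
  qed
qed

text \<open>The factor t^n is a tilt that raises \<open>a\<close> by n. The Pochhammer form is the
  one that cancels against binomial coefficients later.\<close>

lemma integral_beta_measure_power:
  assumes "a > 0" "b > 0"
  shows "(LINT t | beta_measure a b. complex_of_real t ^ n) =
    of_real (Beta a b * pochhammer a n / pochhammer (a + b) n)"
proof -
  have nz: "a \<notin> \<int>\<^sub>\<le>\<^sub>0" "a + b \<notin> \<int>\<^sub>\<le>\<^sub>0" "a + real n + b \<notin> \<int>\<^sub>\<le>\<^sub>0"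
    using assms by (auto elim!: nonpos_Ints_cases)
  have "(LINT t | beta_measure a b. complex_of_real t ^ n) =
      (LINT t | beta_measure a b. (t powr real n * (1 - t) powr 0) *\<^sub>R (1::complex))"
    by (intro integral_cong_AE)
       (auto intro!: eventually_mono[OF AE_beta_measure] simp: powr_realpow scaleR_conv_of_real)
  also have "\<dots> = of_real (Beta (a + n) b)"
    using assms by (subst integral_beta_measure_tilt) (auto simp: measure_beta_measure scaleR_conv_of_real)
  also have "Beta (a + n) b = Beta a b * pochhammer a n / pochhammer (a + b) n"
    using assms nz by (simp add: Beta_def pochhammer_Gamma divide_simps Gamma_eq_zero_iff add_ac)
  finally show ?thesis .
qed

lemma sums_integral_beta_measure_power_series:
  fixes h :: "nat \<Rightarrow> complex"
  assumes "a > 0" "b > 0" and h: "summable (\<lambda>n. norm (h n))"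
  shows "(\<lambda>n. h n * of_real (Beta a b * pochhammer a n / pochhammer (a + b) n)) sums
    (LINT t | beta_measure a b. (\<Sum>n. h n * of_real t ^ n))"
proof -
  interpret finite_measure "beta_measure a b"
    using assms by (simp add: finite_measure_beta_measure)
  have "(\<lambda>n. LINT t | beta_measure a b. h n * of_real t ^ n) sums
      (LINT t | beta_measure a b. (\<Sum>n. h n * of_real t ^ n))"
  proof (rule sums_integral_uniformly_bounded[OF _ _ h])
    show "AE t in beta_measure a b. norm (h n * of_real t ^ n) \<le> norm (h n)" for n
      using AE_beta_measure
      by eventually_elim (auto simp: norm_mult norm_power intro!: mult_left_le power_le_one)
  qed simp
  then show ?thesis
    using assms by (simp add: integral_beta_measure_power)
qed

lemma nn_integral_weighted_area_radial:
  fixes f :: "real \<Rightarrow> ennreal"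
  assumes [measurable]: "f \<in> borel_measurable borel" and "\<alpha> > -1"
  shows "(\<integral>\<^sup>+ z. f ((cmod z)\<^sup>2) \<partial>weighted_area \<alpha>) =
    ennreal (1 + \<alpha>) * (\<integral>\<^sup>+ x. f x \<partial>beta_measure 1 (1 + \<alpha>))"
proof -
  have "(\<integral>\<^sup>+ z. f ((cmod z)\<^sup>2) \<partial>weighted_area \<alpha>) =
      (\<integral>\<^sup>+ x. ennreal ((1 + \<alpha>) * (1 - x) powr \<alpha>) * f x * indicator {0<..<1} x \<partial>lborel)"
    by (subst nn_integral_weighted_area, simp, subst nn_integral_disk_area_radial[symmetric]) auto
  also have "\<dots> = (\<integral>\<^sup>+ x. ennreal (1 + \<alpha>) * (ennreal (indicator {0<..<1} x *
      (x powr (1 - 1) * (1 - x) powr (1 + \<alpha> - 1))) * f x) \<partial>lborel)"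
    using \<open>\<alpha> > -1\<close> by (intro nn_integral_cong) (auto simp: indicator_def ennreal_mult mult_ac)
  also have "\<dots> = ennreal (1 + \<alpha>) * (\<integral>\<^sup>+ x. f x \<partial>beta_measure 1 (1 + \<alpha>))"
    unfolding beta_measure_def by (simp add: nn_integral_cmult nn_integral_density)
  finally show ?thesis .
qed

lemma emeasure_weighted_area:
  assumes "\<alpha> > -1"
  shows "emeasure (weighted_area \<alpha>) unit_disk = 1"
proof -
  have "emeasure (weighted_area \<alpha>) unit_disk = (\<integral>\<^sup>+ z. 1 \<partial>weighted_area \<alpha>)"
    using space_weighted_area[of \<alpha>] by (simp del: space_weighted_area)
  also have "\<dots> = ennreal (1 + \<alpha>) * ennreal (Beta 1 (1 + \<alpha>))"
    using nn_integral_weighted_area_radial[of "\<lambda>_. 1" \<alpha>] assms by (simp add: emeasure_beta_measure)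
  also have "\<dots> = ennreal ((1 + \<alpha>) * Beta 1 (1 + \<alpha>))"
    using assms by (simp add: ennreal_mult' )
  also have "(1 + \<alpha>) * Beta 1 (1 + \<alpha>) = 1"
    using assms by (simp add: Beta_real_1_left)
  finally show ?thesis by simp
qed

lemma finite_measure_weighted_area: "\<alpha> > -1 \<Longrightarrow> finite_measure (weighted_area \<alpha>)"
  by (rule finite_measureI) (simp add: emeasure_weighted_area)

text \<open>Off the diagonal, a suitable rotation multiplies the integrand by -1 and the integral is
  its own negative. On the diagonal the integrand is radial, and its integral is a moment of the
  Beta measure with first parameter 1.\<close>

lemma integral_weighted_area_monomials:
  assumes "\<alpha> > -1"
  shows "(LINT w | weighted_area \<alpha>. w ^ n * cnj w ^ m) =
    (if n = m then of_real (fact n / pochhammer (2 + \<alpha>) n) else 0)"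
proof (cases "n = m")
  case False
  \<comment> \<open>A rotation by \<theta> multiplies the monomial by cis ((n - m) \<theta>), which
    is -1 for this angle.\<close>
  define \<theta> where "\<theta> = pi / (real n - real m)"
  have "cis \<theta> ^ n * cnj (cis \<theta>) ^ m = cis (real n * \<theta> - real m * \<theta>)"
    by (simp add: Complex.DeMoivre cis_cnj cis_mult)
  also have "real n * \<theta> - real m * \<theta> = pi"
    using False by (simp add: \<theta>_def flip: left_diff_distrib diff_divide_distrib)
  finally have *: "cis \<theta> ^ n * cnj (cis \<theta>) ^ m = -1" by simp
  have "(\<lambda>w. (cis \<theta> * w) ^ n * cnj (cis \<theta> * w) ^ m) = (\<lambda>w. - (w ^ n * cnj w ^ m))"
  proof
    fix w
    have "(cis \<theta> * w) ^ n * cnj (cis \<theta> * w) ^ m = (cis \<theta> ^ n * cnj (cis \<theta>) ^ m) * (w ^ n * cnj w ^ m)"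
      by (simp add: power_mult_distrib mult_ac del: cis_cnj)
    then show "(cis \<theta> * w) ^ n * cnj (cis \<theta> * w) ^ m = - (w ^ n * cnj w ^ m)"
      unfolding * by simp
  qed
  moreover have "(LINT w | weighted_area \<alpha>. (cis \<theta> * w) ^ n * cnj (cis \<theta> * w) ^ m) =
      (LINT w | weighted_area \<alpha>. w ^ n * cnj w ^ m)"
    by (rule integral_weighted_area_rotate) auto
  ultimately show ?thesis using False by simp
next
  case True
  have "w ^ n * cnj w ^ n = complex_of_real (((cmod w)\<^sup>2) ^ n)" for w
    by (simp add: power_mult_distrib[symmetric] complex_norm_square[symmetric])
  then have "(LINT w | weighted_area \<alpha>. w ^ n * cnj w ^ m) =
      of_real (LINT w | weighted_area \<alpha>. ((cmod w)\<^sup>2) ^ n)"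
    using True by (simp only: integral_complex_of_real)
  also have "(LINT w | weighted_area \<alpha>. ((cmod w)\<^sup>2) ^ n) =
      enn2real (\<integral>\<^sup>+ w. ennreal (((cmod w)\<^sup>2) ^ n) \<partial>weighted_area \<alpha>)"
    by (rule integral_eq_nn_integral) auto
  also have "\<dots> = (1 + \<alpha>) * enn2real (\<integral>\<^sup>+ x. ennreal (x ^ n) \<partial>beta_measure 1 (1 + \<alpha>))"
    using assms nn_integral_weighted_area_radial[of "\<lambda>x. ennreal (x ^ n)" \<alpha>]
    by (simp add: enn2real_mult)
  also have "enn2real (\<integral>\<^sup>+ x. ennreal (x ^ n) \<partial>beta_measure 1 (1 + \<alpha>)) =
      (LINT x | beta_measure 1 (1 + \<alpha>). x ^ n)"
    by (intro integral_eq_nn_integral[symmetric]) (auto intro!: eventually_mono[OF AE_beta_measure])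
  also have "\<dots> = Beta 1 (1 + \<alpha>) * pochhammer 1 n / pochhammer (1 + (1 + \<alpha>)) n"
    using integral_beta_measure_power[of 1 "1 + \<alpha>" n] assms
    by (simp flip: of_real_power of_real_mult of_real_divide)
  also have "(1 + \<alpha>) * \<dots> = fact n / pochhammer (2 + \<alpha>) n"
    using assms Beta_real_1_left[of "1 + \<alpha>"] by (simp add: pochhammer_fact[symmetric] flip: add.assoc)
  finally show ?thesis using True by simp
qed

section \<open>Absolutely convergent power series on the disk\<close>

lemma norm_power_series_term_le:
  "cmod w \<le> 1 \<Longrightarrow> norm (a * w ^ n) \<le> norm a" for a w :: complex
  by (simp add: norm_mult norm_power mult_left_le power_le_one)

text \<open>Parseval's identity in bilinear form: orthogonality of monomials leaves only the
  diagonal. The two coefficient sequences are unrelated, which later allows different exponents on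
  the holomorphic and antiholomorphic factors. Absolute summability up to the boundary justifies
  integrating termwise in each series in turn.\<close>

lemma sums_integral_weighted_area_power_series:
  fixes a b :: "nat \<Rightarrow> complex"
  assumes \<alpha>: "\<alpha> > -1" and a: "summable (\<lambda>n. norm (a n))" and b: "summable (\<lambda>n. norm (b n))"
  shows "(\<lambda>n. a n * b n * of_real (fact n / pochhammer (2 + \<alpha>) n)) sums
    (LINT w | weighted_area \<alpha>. (\<Sum>n. a n * w ^ n) * (\<Sum>n. b n * cnj w ^ n))"
proof -
  interpret finite_measure "weighted_area \<alpha>"
    using \<alpha> by (rule finite_measure_weighted_area)
  let ?M = "weighted_area \<alpha>"
  define A where "A w = (\<Sum>n. a n * w ^ n)" for w
  have [measurable]: "A \<in> borel_measurable borel" unfolding A_def by measurable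
  have AE_disk: "AE w in ?M. cmod w \<le> 1"
    by (rule AE_I2) simp
  have sum_a: "summable (\<lambda>n. a n * w ^ n)" and sum_b: "summable (\<lambda>n. b n * w ^ n)" if "cmod w \<le> 1" for w
    using summable_comparison_test'[OF a norm_power_series_term_le[OF that]]
      summable_comparison_test'[OF b norm_power_series_term_le[OF that]] by auto
  have A_le: "norm (A w) \<le> (\<Sum>n. norm (a n))" if "cmod w \<le> 1" for w
  proof -
    have *: "summable (\<lambda>n. norm (a n * w ^ n))"
      using norm_power_series_term_le[OF that] by (intro summable_comparison_test'[OF a]) auto
    have "norm (A w) \<le> (\<Sum>n. norm (a n * w ^ n))" unfolding A_def using * by (rule summable_norm)
    also have "\<dots> \<le> (\<Sum>n. norm (a n))"
      using norm_power_series_term_le[OF that] * a by (intro suminf_le) auto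
    finally show ?thesis .
  qed
  \<comment> \<open>Integration against a single antiholomorphic monomial extracts one coefficient
    of \<open>A\<close>.\<close>
  have inner: "(LINT w | ?M. A w * cnj w ^ m) = a m * of_real (fact m / pochhammer (2 + \<alpha>) m)" for m
  proof -
    have "(\<lambda>n. LINT w | ?M. a n * w ^ n * cnj w ^ m) sums (LINT w | ?M. (\<Sum>n. a n * w ^ n * cnj w ^ m))"
    proof (rule sums_integral_uniformly_bounded[OF _ _ a])
      show "AE w in ?M. norm (a n * w ^ n * cnj w ^ m) \<le> norm (a n)" for n
        using AE_disk
      proof eventually_elim
        case (elim w)
        have "norm (a n * w ^ n * cnj w ^ m) \<le> norm (a n * w ^ n)"
          using elim by (intro norm_power_series_term_le) simp
        also have "\<dots> \<le> norm (a n)"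
          using elim by (rule norm_power_series_term_le)
        finally show ?case .
      qed
    qed simp
    also have "(LINT w | ?M. (\<Sum>n. a n * w ^ n * cnj w ^ m)) = (LINT w | ?M. A w * cnj w ^ m)"
      unfolding A_def by (rule Bochner_Integration.integral_cong) (simp_all add: suminf_mult2 sum_a)
    also have "(\<lambda>n. LINT w | ?M. a n * w ^ n * cnj w ^ m) =
        (\<lambda>n. if n = m then a n * of_real (fact n / pochhammer (2 + \<alpha>) n) else 0)"
      using integral_weighted_area_monomials[OF \<alpha>] by (auto simp: mult.assoc)
    finally show ?thesis
      by (rule sums_unique2[OF _ sums_single])
  qed
  have "(\<lambda>m. LINT w | ?M. A w * (b m * cnj w ^ m)) sums (LINT w | ?M. (\<Sum>m. A w * (b m * cnj w ^ m)))"
  proof (rule sums_integral_uniformly_bounded[OF _ _ summable_mult[OF b]])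
    show "AE w in ?M. norm (A w * (b m * cnj w ^ m)) \<le> (\<Sum>n. norm (a n)) * norm (b m)" for m
      using AE_disk
      by eventually_elim
         (simp only: norm_mult[of "A _"], intro mult_mono A_le norm_power_series_term_le suminf_nonneg a, auto)
  qed simp
  also have "(LINT w | ?M. (\<Sum>m. A w * (b m * cnj w ^ m))) =
      (LINT w | ?M. A w * (\<Sum>m. b m * cnj w ^ m))"
    by (rule Bochner_Integration.integral_cong) (simp_all add: suminf_mult sum_b)
  also have "(\<lambda>m. LINT w | ?M. A w * (b m * cnj w ^ m)) =
      (\<lambda>m. a m * b m * of_real (fact m / pochhammer (2 + \<alpha>) m))"
    using inner by (auto simp: mult.left_commute[of _ "b _"] fun_eq_iff)
  finally show ?thesis by (simp add: A_def)
qed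

section \<open>The Forelli--Rudin estimate\<close>

text \<open>The two alternating signs cancel and leave Pochhammer coefficients. For positive
  \<open>a\<close> these are nonnegative, so absolute convergence reduces to the real binomial
  series at |z|.\<close>

lemma sums_binomial_complex:
  fixes z :: complex
  assumes "cmod z < 1"
  shows "(\<lambda>n. of_real (pochhammer a n / fact n) * z ^ n) sums (1 - z) powr of_real (- a)"
proof -
  have *: "(of_real (- a) gchoose n) * (- z) ^ n = of_real (pochhammer a n / fact n) * z ^ n" for n
  proof -
    have "(of_real (- a) gchoose n) * (- z) ^ n =
        ((-1) ^ n * (-1) ^ n) * (pochhammer (of_real a) n / fact n * z ^ n)"
      unfolding gbinomial_pochhammer power_minus[of z] by simp
    also have "(-1) ^ n * (-1) ^ n = (1::complex)"
      by (simp flip: power_mult_distrib)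
    finally show ?thesis by (simp add: pochhammer_of_real)
  qed
  show ?thesis
    using gen_binomial_complex[of "- z" "of_real (- a)"] assms unfolding * by simp
qed

lemma sums_binomial_real:
  fixes x :: real
  assumes "0 \<le> x" "x < 1"
  shows "(\<lambda>n. pochhammer a n / fact n * x ^ n) sums (1 - x) powr (- a)"
proof -
  have "(\<lambda>n. complex_of_real (pochhammer a n / fact n * x ^ n)) sums of_real ((1 - x) powr (- a))"
    using sums_binomial_complex[of "of_real x" a] assms powr_of_real[of "1 - x" "- a"] by simp
  then show ?thesis by (simp only: sums_of_real_iff)
qed

lemma summable_norm_binomial:
  fixes z :: complex
  assumes "cmod z < 1" "a > 0"
  shows "summable (\<lambda>n. norm (of_real (pochhammer a n / fact n) * z ^ n))"
proof -
  have "summable (\<lambda>n. pochhammer a n / fact n * cmod z ^ n)"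
    using sums_binomial_real[of "cmod z" a] assms by (auto intro: sums_summable)
  then show ?thesis
    using assms by (simp add: norm_mult norm_power norm_divide pochhammer_nonneg)
qed

lemma Gamma_midpoint_le:
  fixes x y :: real
  assumes "x > 0" "y > 0"
  shows "(Gamma ((x + y) / 2))\<^sup>2 \<le> Gamma x * Gamma y"
proof -
  have pos: "Gamma x > 0" "Gamma y > 0" "Gamma ((x + y) / 2) > 0"
    using assms by simp_all
  have "ln (Gamma ((1 - 1/2) *\<^sub>R x + (1/2) *\<^sub>R y)) \<le> (1 - 1/2) * ln (Gamma x) + 1/2 * ln (Gamma y)"
    using convex_onD[OF log_convex_Gamma_real, of "1/2" x y] assms by simp
  then have "2 * ln (Gamma ((x + y) / 2)) \<le> ln (Gamma x) + ln (Gamma y)"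
    by (simp add: field_simps)
  then have "ln ((Gamma ((x + y) / 2))\<^sup>2) \<le> ln (Gamma x * Gamma y)"
    using pos by (simp add: ln_realpow ln_mult)
  then show ?thesis using pos by (subst (asm) ln_le_cancel_iff) auto
qed

section \<open>Modulus and conjugation of the kernel\<close>

lemma Re_one_minus_pos: "cmod u < 1 \<Longrightarrow> Re (1 - u) > 0"
  using complex_Re_le_cmod[of u] by simp

lemma cnj_powr_of_real:
  assumes "Re z > 0"
  shows "cnj z powr of_real r = cnj (z powr of_real r)"
  using assms cnj_powr[of z "of_real r"] by auto

lemma norm_powr_of_real: "cmod (z powr of_real r) = cmod z powr r"
  by (simp add: norm_powr_real_powr')

lemma norm_mult_cnj_less_1: "cmod z < 1 \<Longrightarrow> cmod w \<le> 1 \<Longrightarrow> cmod (z * cnj w) < 1"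
  by (simp add: norm_mult) (metis mult_left_le norm_ge_zero order_le_less_trans)

lemma one_minus_norm_le: "cmod w \<le> 1 \<Longrightarrow> 1 - cmod z \<le> cmod (1 - z * cnj w)"
  using norm_triangle_ineq2[of 1 "z * cnj w"] mult_left_le[of "cmod w" "cmod z"]
  by (simp add: norm_mult)

text \<open>
  Expanding the kernel, only the diagonal terms survive the integration; they are compared
  one by one with those of the binomial series on the right by log-convexity of \<open>\<Gamma>\<close>.
\<close>

lemma forelli_rudin:
  assumes t: "t > -1" and d: "d > 0" and z: "cmod z < 1"
  shows "(\<integral>\<^sup>+ w. ennreal (cmod (1 - z * cnj w) powr - (2 + t + d)) \<partial>weighted_area t) \<le>
    ennreal (Gamma (2 + t) * Gamma d / (Gamma ((2 + t + d) / 2))\<^sup>2 * (1 - (cmod z)\<^sup>2) powr (- d))"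
proof -
  interpret finite_measure "weighted_area t"
    using t by (rule finite_measure_weighted_area)
  \<comment> \<open>Half the exponent: the modulus to the power -2l is the power -l of 1 - z
    \<open>cnj w\<close> times its own conjugate, a product of a holomorphic and an antiholomorphic
    series in w.\<close>
  define l where "l = (2 + t + d) / 2"
  have l: "l > 0" using t d by (simp add: l_def)
  define r where "r n = pochhammer l n / fact n" for n
  have r0: "r n \<ge> 0" for n using l by (simp add: r_def pochhammer_nonneg)
  define C where "C = Gamma (2 + t) * Gamma d / (Gamma l)\<^sup>2"
  define x where "x = (cmod z)\<^sup>2"
  have x: "0 \<le> x" "x < 1"
    using z by (auto simp: x_def power_less_one_iff abs_square_less_1)
  define F where "F w = cmod (1 - z * cnj w) powr - (2 + t + d)" for w
  have [measurable]: "F \<in> borel_measurable borel" unfolding F_def by measurable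
  have prod: "(\<Sum>n. of_real (r n) * cnj z ^ n * w ^ n) * (\<Sum>n. of_real (r n) * z ^ n * cnj w ^ n) =
      of_real (F w)" if "cmod w < 1" for w
  proof -
    have less: "cmod (z * cnj w) < 1" using z that by (intro norm_mult_cnj_less_1) auto
    then have less': "cmod (cnj z * w) < 1" by (simp add: norm_mult)
    define u where "u = (1 - z * cnj w) powr of_real (- l)"
    have "(\<Sum>n. of_real (r n) * z ^ n * cnj w ^ n) = u"
      using sums_unique[OF sums_binomial_complex[OF less, of l]]
      by (simp add: u_def r_def power_mult_distrib mult_ac)
    moreover have "(\<Sum>n. of_real (r n) * cnj z ^ n * w ^ n) = cnj u"
      using sums_unique[OF sums_binomial_complex[OF less', of l]]
        cnj_powr_of_real[OF Re_one_minus_pos[OF less], of "- l"]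
      by (simp add: u_def r_def power_mult_distrib mult_ac)
    moreover have "cnj u * u = of_real ((cmod u)\<^sup>2)"
      by (simp add: complex_norm_square mult.commute del: of_real_power)
    moreover have "(cmod u)\<^sup>2 = F w"
      unfolding u_def F_def norm_powr_of_real power2_eq_square powr_add[symmetric]
      by (rule arg_cong[where f = "(powr) _"]) (simp add: l_def)
    ultimately show ?thesis by simp
  qed
  have sum: "summable (\<lambda>n. norm (complex_of_real (r n) * z ^ n))"
    "summable (\<lambda>n. norm (complex_of_real (r n) * cnj z ^ n))"
    unfolding r_def using z l by (intro summable_norm_binomial; simp)+
  \<comment> \<open>The diagonal term: two binomial coefficients, |z|^(2n), and the integral of
    |w|^(2n).\<close>
  define T where "T n = r n * r n * x ^ n * (fact n / pochhammer (2 + t) n)" for n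
  have "(\<lambda>n. complex_of_real (T n)) sums (LINT w | weighted_area t. of_real (F w))"
  proof -
    have "(LINT w | weighted_area t. of_real (F w)) =
      (LINT w | weighted_area t. (\<Sum>n. of_real (r n) * cnj z ^ n * w ^ n) *
         (\<Sum>n. of_real (r n) * z ^ n * cnj w ^ n))"
      by (rule Bochner_Integration.integral_cong) (simp_all add: prod)
    moreover have "complex_of_real (T n) = (of_real (r n) * cnj z ^ n) * (of_real (r n) * z ^ n) *
       of_real (fact n / pochhammer (2 + t) n)" for n
    proof -
      have "z * cnj z = of_real x"
        unfolding x_def by (rule complex_norm_square[symmetric])
      then have "cnj z ^ n * z ^ n = of_real (x ^ n)"
        by (simp add: power_mult_distrib[symmetric] mult.commute)
      moreover have "(of_real (r n) * cnj z ^ n) * (of_real (r n) * z ^ n) *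
          of_real (fact n / pochhammer (2 + t) n) =
          of_real (r n) * of_real (r n) * (cnj z ^ n * z ^ n) * of_real (fact n / pochhammer (2 + t) n)"
        by (simp only: mult_ac)
      ultimately show ?thesis by (simp only: T_def of_real_mult)
    qed
    ultimately show ?thesis
      using sums_integral_weighted_area_power_series[OF t sum(2) sum(1)] by (simp only:)
  qed
  then have T: "T sums (LINT w | weighted_area t. F w)"
    by (simp only: integral_complex_of_real sums_of_real_iff)
  have T_le: "T n \<le> C * (pochhammer d n / fact n * x ^ n)" for n
  proof -
    have nz: "l \<notin> \<int>\<^sub>\<le>\<^sub>0" "d \<notin> \<int>\<^sub>\<le>\<^sub>0" "2 + t \<notin> \<int>\<^sub>\<le>\<^sub>0"
      using l d t by (intro pos_not_nonpos_Ints; simp)+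
    have pos: "Gamma l > 0" "Gamma d > 0" "Gamma (2 + t) > 0" "Gamma (2 + t + n) > 0"
      using l d t by simp_all
    \<comment> \<open>The midpoint of 2+t+n and d+n is l+n, so log-convexity replaces the squared
      numerator of the coefficient by a product whose first factor cancels.\<close>
    have "(Gamma (l + n))\<^sup>2 \<le> Gamma (2 + t + n) * Gamma (d + n)"
      using Gamma_midpoint_le[of "2 + t + n" "d + n"] t d by (simp add: l_def field_simps)
    then have "(Gamma (l + n))\<^sup>2 / Gamma (2 + t + n) * (x ^ n * Gamma (2 + t) / (fact n * (Gamma l)\<^sup>2)) \<le>
        Gamma (d + n) * (x ^ n * Gamma (2 + t) / (fact n * (Gamma l)\<^sup>2))"
      using pos x by (intro mult_right_mono) (auto simp: divide_simps mult.commute)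
    moreover have "(Gamma (l + n))\<^sup>2 / Gamma (2 + t + n) * (x ^ n * Gamma (2 + t) / (fact n * (Gamma l)\<^sup>2)) = T n"
      using nz pos by (simp add: T_def r_def pochhammer_Gamma power2_eq_square divide_simps)
    moreover have "Gamma (d + n) * (x ^ n * Gamma (2 + t) / (fact n * (Gamma l)\<^sup>2)) =
        C * (pochhammer d n / fact n * x ^ n)"
      using nz pos by (simp add: C_def pochhammer_Gamma divide_simps)
    ultimately show ?thesis by (simp only:)
  qed
  have bound: "(LINT w | weighted_area t. F w) \<le> C * (1 - x) powr (- d)"
    using T_le T sums_mult[OF sums_binomial_real[OF x, of d], of C] by (rule sums_le)
  have "integrable (weighted_area t) F"
  proof (rule integrable_const_bound)
    have "F w \<le> (1 - cmod z) powr - (2 + t + d)" if "cmod w < 1" for w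
      unfolding F_def using z t d that one_minus_norm_le[of w z]
      by (intro powr_mono2') auto
    then show "AE w in weighted_area t. norm (F w) \<le> (1 - cmod z) powr - (2 + t + d)"
      by (intro AE_I2) (auto simp: F_def)
  qed simp
  then have "(\<integral>\<^sup>+ w. ennreal (F w) \<partial>weighted_area t) = ennreal (LINT w | weighted_area t. F w)"
    by (rule nn_integral_eq_integral) (simp add: F_def)
  also have "\<dots> \<le> ennreal (C * (1 - x) powr (- d))"
    using bound by (rule ennreal_leI)
  finally show ?thesis unfolding F_def C_def l_def x_def .
qed

text \<open>The factor (1-|w|^2)^(-d) changes the area measure of parameter \<alpha> into a multiple
  of the one of parameter t = \<alpha> - d. The kernel exponent 2+\<alpha> is then 2+t+d, so the
  Gamma value in the denominator does not depend on d.\<close>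

lemma forelli_rudin_weighted:
  assumes \<alpha>: "\<alpha> > -1" and d: "0 < d" "d < 1 + \<alpha>" and z: "cmod z < 1"
  shows "(\<integral>\<^sup>+ w. ennreal ((1 - (cmod w)\<^sup>2) powr (- d) * cmod (1 - z * cnj w) powr - (2 + \<alpha>))
      \<partial>weighted_area \<alpha>) \<le>
    ennreal ((1 + \<alpha>) * (Gamma (1 + \<alpha> - d) * Gamma d / (Gamma ((2 + \<alpha>) / 2))\<^sup>2) * (1 - (cmod z)\<^sup>2) powr (- d))"
proof -
  define t where "t = \<alpha> - d"
  have t: "t > -1" using d by (simp add: t_def)
  have "(\<integral>\<^sup>+ w. ennreal ((1 - (cmod w)\<^sup>2) powr (- d) * cmod (1 - z * cnj w) powr - (2 + \<alpha>))
      \<partial>weighted_area \<alpha>) =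
      (\<integral>\<^sup>+ w. ennreal ((1 + \<alpha>) * (1 - (cmod w)\<^sup>2) powr \<alpha>) *
        ennreal ((1 - (cmod w)\<^sup>2) powr (- d) * cmod (1 - z * cnj w) powr - (2 + \<alpha>)) \<partial>disk_area)"
    by (rule nn_integral_weighted_area) measurable
  also have "\<dots> = (\<integral>\<^sup>+ w. ennreal ((1 + t) * (1 - (cmod w)\<^sup>2) powr t) *
       (ennreal ((1 + \<alpha>) / (1 + t)) * ennreal (cmod (1 - z * cnj w) powr - (2 + t + d))) \<partial>disk_area)"
  proof (rule nn_integral_cong)
    fix w
    have "ennreal ((1 + \<alpha>) * (1 - (cmod w)\<^sup>2) powr \<alpha>) *
        ennreal ((1 - (cmod w)\<^sup>2) powr (- d) * cmod (1 - z * cnj w) powr - (2 + \<alpha>)) =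
        ennreal ((1 + \<alpha>) * ((1 - (cmod w)\<^sup>2) powr \<alpha> * (1 - (cmod w)\<^sup>2) powr (- d)) *
          cmod (1 - z * cnj w) powr - (2 + \<alpha>))"
      using \<alpha> by (subst ennreal_mult[symmetric]) (auto simp: mult_ac)
    also have "(1 - (cmod w)\<^sup>2) powr \<alpha> * (1 - (cmod w)\<^sup>2) powr (- d) = (1 - (cmod w)\<^sup>2) powr t"
      by (simp add: t_def powr_add[symmetric])
    also have "ennreal ((1 + \<alpha>) * (1 - (cmod w)\<^sup>2) powr t * cmod (1 - z * cnj w) powr - (2 + \<alpha>)) =
       ennreal ((1 + t) * (1 - (cmod w)\<^sup>2) powr t) *
       (ennreal ((1 + \<alpha>) / (1 + t)) * ennreal (cmod (1 - z * cnj w) powr - (2 + t + d)))"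
      using \<alpha> t by (simp add: ennreal_mult[symmetric] t_def)
    finally show "ennreal ((1 + \<alpha>) * (1 - (cmod w)\<^sup>2) powr \<alpha>) *
        ennreal ((1 - (cmod w)\<^sup>2) powr (- d) * cmod (1 - z * cnj w) powr - (2 + \<alpha>)) = \<dots>" .
  qed
  also have "\<dots> = (\<integral>\<^sup>+ w. ennreal ((1 + \<alpha>) / (1 + t)) * ennreal (cmod (1 - z * cnj w) powr - (2 + t + d))
      \<partial>weighted_area t)"
    by (rule nn_integral_weighted_area[symmetric]) measurable
  also have "\<dots> = ennreal ((1 + \<alpha>) / (1 + t)) *
      (\<integral>\<^sup>+ w. ennreal (cmod (1 - z * cnj w) powr - (2 + t + d)) \<partial>weighted_area t)"
    by (rule nn_integral_cmult) measurable
  also have "\<dots> \<le> ennreal ((1 + \<alpha>) / (1 + t)) *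
      ennreal (Gamma (2 + t) * Gamma d / (Gamma ((2 + t + d) / 2))\<^sup>2 * (1 - (cmod z)\<^sup>2) powr (- d))"
    by (intro mult_left_mono forelli_rudin t d z) simp
  also have "\<dots> = ennreal ((1 + \<alpha>) / (1 + t) *
      (Gamma (2 + t) * Gamma d / (Gamma ((2 + t + d) / 2))\<^sup>2 * (1 - (cmod z)\<^sup>2) powr (- d)))"
    using t \<alpha> by (intro ennreal_mult'[symmetric]) simp
  also have "(1 + \<alpha>) / (1 + t) *
      (Gamma (2 + t) * Gamma d / (Gamma ((2 + t + d) / 2))\<^sup>2 * (1 - (cmod z)\<^sup>2) powr (- d)) =
     (1 + \<alpha>) * (Gamma (1 + \<alpha> - d) * Gamma d / (Gamma ((2 + \<alpha>) / 2))\<^sup>2) * (1 - (cmod z)\<^sup>2) powr (- d)"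
  proof -
    \<comment> \<open>This factor 1+t cancels the normalization of the measure of parameter
      t.\<close>
    have G: "Gamma (2 + t) = (1 + t) * Gamma (1 + t)"
      using Gamma_plus1[of "1 + t"] pos_not_nonpos_Ints[of "1 + t"] t by (simp add: add_ac)
    have eqs: "2 + t + d = 2 + \<alpha>" "1 + \<alpha> - d = 1 + t" by (simp_all add: t_def)
    show ?thesis unfolding eqs G using t by simp
  qed
  finally show ?thesis .
qed

section \<open>The upper bound\<close>

lemma conjugate_exponent:
  fixes p q :: real
  assumes "p > 1" "q = p / (p - 1)"
  shows "q > 1" "1 / p + 1 / q = 1" "p / q = p - 1"
proof -
  show "q > 1" using assms by simp
  show "p / q = p - 1" using assms by simp
  then show "1 / p + 1 / q = 1" using assms by (simp add: diff_divide_distrib)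
qed

text \<open>Optimizing Young's inequality over the scaling \<tau> yields Hoelder's inequality raised
  to the p-th power. In Schur's test this is applied at each point z.\<close>

lemma powr_le_of_young_bound:
  fixes p q X Y y :: real
  assumes p: "p > 1" and q: "q = p / (p - 1)" and X: "X \<ge> 0" and Y: "Y > 0" and y: "y \<ge> 0"
    and le: "\<And>\<tau>. \<tau> > 0 \<Longrightarrow> y \<le> \<tau> powr p / p * X + \<tau> powr (- q) / q * Y"
  shows "y powr p \<le> Y powr (p / q) * X"
proof -
  note q1 = conjugate_exponent(1)[OF p q] and pq = conjugate_exponent(2)[OF p q]
  \<comment> \<open>The optimal scaling contains a negative power of \<open>X\<close>, which may be
    0; a larger \<open>Z\<close> avoids this and is let down to \<open>X\<close> at the end.\<close>
  have "y powr p \<le> Y powr (p / q) * Z" if Z: "Z > X" for Z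
  proof -
    have Z0: "Z > 0" using X Z by simp
    \<comment> \<open>The solution of \<tau>^p Z = \<tau>^(-q) Y, since p + q = pq. It makes the two
      Young terms proportional to 1/p and 1/q.\<close>
    define \<tau> where "\<tau> = Y powr (1 / (p * q)) * Z powr (- 1 / (p * q))"
    have \<tau>: "\<tau> > 0" using Y Z0 by (simp add: \<tau>_def)
    have *: "\<tau> powr p * Z = Y powr (1 / q) * Z powr (1 / p)"
    proof -
      have "\<tau> powr p * Z = Y powr (1 / q) * (Z powr (- 1 / q) * Z powr 1)"
        using p q1 Y Z0 by (simp add: \<tau>_def powr_mult powr_powr)
      also have "Z powr (- 1 / q) * Z powr 1 = Z powr (1 / p)"
        unfolding powr_add[symmetric] using pq by (intro arg_cong[where f = "(powr) Z"]) linarith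
      finally show ?thesis .
    qed
    have **: "\<tau> powr (- q) * Y = Y powr (1 / q) * Z powr (1 / p)"
    proof -
      have "\<tau> powr (- q) * Y = (Y powr (- 1 / p) * Y powr 1) * Z powr (1 / p)"
        using p q1 Y Z0 by (simp add: \<tau>_def powr_mult powr_powr)
      also have "Y powr (- 1 / p) * Y powr 1 = Y powr (1 / q)"
        unfolding powr_add[symmetric] using pq by (intro arg_cong[where f = "(powr) Y"]) linarith
      finally show ?thesis .
    qed
    have "y \<le> \<tau> powr p / p * X + \<tau> powr (- q) / q * Y" by (rule le[OF \<tau>])
    also have "\<dots> \<le> \<tau> powr p / p * Z + \<tau> powr (- q) / q * Y"
      using Z p by (intro add_right_mono mult_left_mono) auto
    also have "\<dots> = (1 / p) * (\<tau> powr p * Z) + (1 / q) * (\<tau> powr (- q) * Y)" by simp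
    also have "\<dots> = (1 / p + 1 / q) * (Y powr (1 / q) * Z powr (1 / p))"
      unfolding * ** by (simp only: distrib_right)
    finally have "y \<le> Y powr (1 / q) * Z powr (1 / p)" by (simp add: pq)
    then have "y powr p \<le> (Y powr (1 / q) * Z powr (1 / p)) powr p"
      using y p by (intro powr_mono2) auto
    also have "\<dots> = Y powr (p / q) * Z"
      using Z0 p by (simp add: powr_mult powr_powr)
    finally show ?thesis .
  qed
  then have "y powr p / Y powr (p / q) \<le> Z" if "Z > X" for Z
    using that Y by (simp add: divide_le_eq mult.commute)
  then have "y powr p / Y powr (p / q) \<le> X"
    by (rule dense_ge)
  then show ?thesis using Y by (simp add: divide_le_eq mult.commute)
qed

text \<open>A non-integrable function has Bochner integral 0 by convention, so the projection can be
  estimated before its defining integral is known to converge.\<close>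

lemma norm_lebesgue_integral_le_nn_integral:
  fixes f :: "'a \<Rightarrow> 'b::{banach, second_countable_topology}"
  shows "ennreal (norm (LINT x | M. f x)) \<le> (\<integral>\<^sup>+ x. ennreal (norm (f x)) \<partial>M)"
  by (cases "integrable M f") (simp_all add: integral_norm_bound_ennreal not_integrable_integral_eq)


section \<open>Schur's test for the projection\<close>

lemma sigma_finite_weighted_area: "\<alpha> > -1 \<Longrightarrow> sigma_finite_measure (weighted_area \<alpha>)"
  using finite_measure_weighted_area by (rule finite_measure.axioms)

lemma nn_integral_bergman_projection_le:
  fixes \<alpha> p q :: real
  assumes \<alpha>: "\<alpha> > -1" and p: "p > 1" and q: "q = p / (p - 1)"
    and f: "f \<in> borel_measurable (lebesgue_on unit_disk)"
  defines "C \<equiv> (1 + \<alpha>) * (Gamma ((1 + \<alpha>) / p) * Gamma ((1 + \<alpha>) / q) / (Gamma ((2 + \<alpha>) / 2))\<^sup>2)"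
  shows "(\<integral>\<^sup>+ z. ennreal (cmod (bergman_projection \<alpha> f z) powr p) \<partial>weighted_area \<alpha>) \<le>
    ennreal (C powr p) * (\<integral>\<^sup>+ z. ennreal (cmod (f z) powr p) \<partial>weighted_area \<alpha>)"
proof -
  let ?M = "weighted_area \<alpha>"
  interpret sigma_finite_measure ?M
    using \<alpha> by (rule sigma_finite_weighted_area)
  interpret pair_sigma_finite ?M ?M ..
  note q1 = conjugate_exponent(1)[OF p q] and pq = conjugate_exponent(2)[OF p q]
    and pdq = conjugate_exponent(3)[OF p q]
  have C: "C > 0"
    unfolding C_def using \<alpha> p q1
    by (intro mult_pos_pos divide_pos_pos zero_less_power Gamma_real_pos) auto
  \<comment> \<open>With Schur weight h = \<open>R w powr (- b / p)\<close>, the q-th power of h is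
    \<open>R w powr (- a)\<close> and its p-th power is \<open>R w powr (- b)\<close>.\<close>
  define a where "a = (1 + \<alpha>) / p"
  define b where "b = (1 + \<alpha>) / q"
  have ab: "a > 0" "b > 0" using \<alpha> p q1 by (simp_all add: a_def b_def)
  have "(1 + \<alpha>) * (1 / p + 1 / q) = 1 + \<alpha>" using pq by simp
  then have sum_ab: "a + b = 1 + \<alpha>" by (simp add: distrib_left a_def b_def)
  have apq: "a * (p / q) = b" "b * q / p = a"
    using p q1 by (simp_all add: a_def b_def)
  define R where "R w = 1 - (cmod w)\<^sup>2" for w :: complex
  have R: "R w > 0" if "cmod w < 1" for w
    using that by (simp add: R_def power_less_one_iff abs_square_less_1)
  define K where "K z w = cmod (1 - z * cnj w) powr - (2 + \<alpha>)" for z w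
  have K0: "K z w \<ge> 0" for z w by (simp add: K_def)
  have K_sym: "K z w = K w z" for z w
  proof -
    have "cmod (1 - z * cnj w) = cmod (cnj (1 - z * cnj w))" by (rule complex_mod_cnj[symmetric])
    also have "cnj (1 - z * cnj w) = 1 - w * cnj z" by simp
    finally show ?thesis by (simp add: K_def)
  qed
  have [measurable]: "f \<in> borel_measurable ?M"
    using f by (simp cong: measurable_cong_sets)
  have [measurable]: "R \<in> borel_measurable borel" "(\<lambda>(z, w). K z w) \<in> borel_measurable borel"
    unfolding R_def K_def borel_prod[symmetric] by measurable
  have K_int: "(\<integral>\<^sup>+ w. ennreal (R w powr (- d) * K z w) \<partial>?M) \<le> ennreal (C * R z powr (- d))"
    if z: "cmod z < 1" and d: "d = a \<or> d = b" for z d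
  proof -
    \<comment> \<open>As a + b = 1+\<alpha>, passing from d to 1+\<alpha>-d exchanges
      \<open>a\<close> and \<open>b\<close>, and both choices of d give the same
      \<open>C\<close>.\<close>
    have "(1 + \<alpha>) * (Gamma (1 + \<alpha> - d) * Gamma d / (Gamma ((2 + \<alpha>) / 2))\<^sup>2) = C"
      using d sum_ab[symmetric] unfolding C_def a_def[symmetric] b_def[symmetric] by auto
    moreover have "0 < d" "d < 1 + \<alpha>" using d ab sum_ab by auto
    ultimately show ?thesis
      using forelli_rudin_weighted[OF \<alpha> _ _ z, of d] by (simp only: R_def K_def)
  qed
  define X where "X z = (\<integral>\<^sup>+ w. ennreal (K z w * R w powr b * cmod (f w) powr p) \<partial>?M)" for z
  have pointwise: "ennreal (cmod (bergman_projection \<alpha> f z) powr p) \<le>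
      ennreal (C powr (p / q) * R z powr (- b)) * X z" if z: "cmod z < 1" for z
  proof (cases "X z = \<infinity>")
    case True
    then show ?thesis using C R[OF z] by (simp add: ennreal_mult_top)
  next
    case False
    then obtain x where x: "x \<ge> 0" "X z = ennreal x" by (cases "X z") auto
    define y where "y = cmod (bergman_projection \<alpha> f z)"
    define Y where "Y = C * R z powr (- a)"
    have Y: "Y > 0" using C R[OF z] by (simp add: Y_def)
    have "y \<le> \<tau> powr p / p * x + \<tau> powr (- q) / q * Y" if \<tau>: "\<tau> > 0" for \<tau>
    proof -
      have "ennreal y \<le> (\<integral>\<^sup>+ w. ennreal (cmod (f w / (1 - z * cnj w) powr of_real (2 + \<alpha>))) \<partial>?M)"
        unfolding y_def bergman_projection_def by (rule norm_lebesgue_integral_le_nn_integral)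
      also have "\<dots> = (\<integral>\<^sup>+ w. ennreal (K z w * cmod (f w)) \<partial>?M)"
        unfolding norm_divide norm_powr_of_real K_def powr_minus by (simp add: divide_inverse mult.commute)
      also have "\<dots> \<le> (\<integral>\<^sup>+ w. ennreal (\<tau> powr p / p) * ennreal (K z w * R w powr b * cmod (f w) powr p) +
          ennreal (\<tau> powr (- q) / q) * ennreal (R w powr (- a) * K z w) \<partial>?M)"
      proof (rule nn_integral_mono)
        fix w assume "w \<in> space ?M"
        then have Rw: "R w > 0" using R by simp
        \<comment> \<open>The weight is inserted together with its inverse; Young's inequality puts
          the inverse with f and the weight itself into the pure kernel integral.\<close>
        have "cmod (f w) = (\<tau> * R w powr (b / p) * cmod (f w)) * (inverse \<tau> * R w powr (- b / p))"
          using \<tau> Rw by (simp add: powr_minus_divide)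
        also have "\<dots> \<le> (\<tau> * R w powr (b / p) * cmod (f w)) powr p / p +
            (inverse \<tau> * R w powr (- b / p)) powr q / q"
          using p q1 pq \<tau> by (intro Youngs_inequality) auto
        also have "(\<tau> * R w powr (b / p) * cmod (f w)) powr p = \<tau> powr p * (R w powr b * cmod (f w) powr p)"
          using p \<tau> by (simp add: powr_mult powr_powr)
        also have "(inverse \<tau> * R w powr (- b / p)) powr q = \<tau> powr (- q) * R w powr (- a)"
          using \<tau> apq(2) by (simp add: powr_mult powr_powr inverse_powr powr_minus)
        finally have "K z w * cmod (f w) \<le> K z w * (\<tau> powr p * (R w powr b * cmod (f w) powr p) / p +
           \<tau> powr (- q) * R w powr (- a) / q)"
          by (rule mult_left_mono) (simp add: K_def)
        also have "\<dots> = \<tau> powr p / p * (K z w * R w powr b * cmod (f w) powr p) +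
           \<tau> powr (- q) / q * (R w powr (- a) * K z w)"
          by (simp add: algebra_simps)
        finally show "ennreal (K z w * cmod (f w)) \<le>
          ennreal (\<tau> powr p / p) * ennreal (K z w * R w powr b * cmod (f w) powr p) +
          ennreal (\<tau> powr (- q) / q) * ennreal (R w powr (- a) * K z w)"
          using p q1 K0[of z w]
          by (subst ennreal_mult'[symmetric], simp, subst ennreal_mult'[symmetric], simp,
              subst ennreal_plus[symmetric]) (simp_all only: ennreal_leI mult_nonneg_nonneg
              divide_nonneg_pos powr_ge_zero norm_ge_zero order.strict_trans[OF zero_less_one])
      qed
      also have "\<dots> = ennreal (\<tau> powr p / p) * X z +
          ennreal (\<tau> powr (- q) / q) * (\<integral>\<^sup>+ w. ennreal (R w powr (- a) * K z w) \<partial>?M)"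
        unfolding X_def K_def by (subst nn_integral_add) (auto simp: nn_integral_cmult)
      also have "\<dots> \<le> ennreal (\<tau> powr p / p) * X z + ennreal (\<tau> powr (- q) / q) * ennreal Y"
        unfolding Y_def using K_int[OF z] by (intro add_left_mono mult_left_mono) auto
      also have "\<dots> = ennreal (\<tau> powr p / p * x + \<tau> powr (- q) / q * Y)"
        using x p q1 Y by (simp add: ennreal_mult'[symmetric] ennreal_plus[symmetric] del: ennreal_plus)
      finally show ?thesis
        using x p q1 Y by (subst (asm) ennreal_le_iff) auto
    qed
    then have "y powr p \<le> Y powr (p / q) * x"
      using p q x Y by (intro powr_le_of_young_bound) (auto simp: y_def)
    also have "Y powr (p / q) = C powr (p / q) * R z powr (- b)"
      using C apq(1) by (simp add: Y_def powr_mult powr_powr)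
    finally show ?thesis
      using x by (simp add: y_def ennreal_mult'[symmetric] ennreal_leI)
  qed
  have "(\<integral>\<^sup>+ z. ennreal (cmod (bergman_projection \<alpha> f z) powr p) \<partial>?M) \<le>
      (\<integral>\<^sup>+ z. ennreal (C powr (p / q) * R z powr (- b)) * X z \<partial>?M)"
    by (intro nn_integral_mono pointwise) simp
  also have "\<dots> = (\<integral>\<^sup>+ z. (\<integral>\<^sup>+ w. ennreal (C powr (p / q) * R z powr (- b)) *
      ennreal (K z w * R w powr b * cmod (f w) powr p) \<partial>?M) \<partial>?M)"
    unfolding X_def K_def by (intro nn_integral_cong nn_integral_cmult[symmetric]) measurable
  \<comment> \<open>With z integrated first and the kernel modulus symmetric, the kernel estimate
    applies again, now at exponent \<open>b\<close>. It contributes one more factor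
    \<open>C\<close>, and p/q + 1 = p.\<close>
  also have "\<dots> = (\<integral>\<^sup>+ w. (\<integral>\<^sup>+ z. ennreal (C powr (p / q) * R z powr (- b)) *
      ennreal (K z w * R w powr b * cmod (f w) powr p) \<partial>?M) \<partial>?M)"
    unfolding K_def by (rule Fubini'[symmetric]) measurable
  also have "\<dots> \<le> (\<integral>\<^sup>+ w. ennreal (C powr p) * ennreal (cmod (f w) powr p) \<partial>?M)"
  proof (rule nn_integral_mono)
    fix w assume "w \<in> space ?M"
    then have w: "cmod w < 1" by simp
    have "(\<integral>\<^sup>+ z. ennreal (C powr (p / q) * R z powr (- b)) *
        ennreal (K z w * R w powr b * cmod (f w) powr p) \<partial>?M) =
      (\<integral>\<^sup>+ z. ennreal (C powr (p / q) * R w powr b * cmod (f w) powr p) *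
        ennreal (R z powr (- b) * K w z) \<partial>?M)"
      by (rule nn_integral_cong) (simp add: ennreal_mult[symmetric] K_sym[of w] K0 mult_ac)
    also have "\<dots> = ennreal (C powr (p / q) * R w powr b * cmod (f w) powr p) *
        (\<integral>\<^sup>+ z. ennreal (R z powr (- b) * K w z) \<partial>?M)"
      unfolding K_def by (rule nn_integral_cmult) measurable
    also have "\<dots> \<le> ennreal (C powr (p / q) * R w powr b * cmod (f w) powr p) *
        ennreal (C * R w powr (- b))"
      by (intro mult_left_mono K_int w) auto
    also have "\<dots> = ennreal ((C powr (p / q) * C powr 1) * (R w powr b * R w powr (- b)) * cmod (f w) powr p)"
      using C by (subst ennreal_mult'[symmetric]) (simp_all add: mult_ac)
    also have "C powr (p / q) * C powr 1 = C powr p"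
      unfolding powr_add[symmetric] pdq by simp
    also have "R w powr b * R w powr (- b) = 1"
      using R[OF w] by (simp add: powr_add[symmetric])
    finally show "(\<integral>\<^sup>+ z. ennreal (C powr (p / q) * R z powr (- b)) *
        ennreal (K z w * R w powr b * cmod (f w) powr p) \<partial>?M) \<le>
        ennreal (C powr p) * ennreal (cmod (f w) powr p)"
      by (simp add: ennreal_mult')
  qed
  also have "\<dots> = ennreal (C powr p) * (\<integral>\<^sup>+ w. ennreal (cmod (f w) powr p) \<partial>?M)"
    by (rule nn_integral_cmult) measurable
  finally show ?thesis .
qed

lemma bergman_norm_le_mult:
  assumes p: "p > 0" and C: "C > 0"
    and le: "(\<integral>\<^sup>+ z. ennreal (cmod (g z) powr p) \<partial>weighted_area \<alpha>) \<le>
      ennreal (C powr p) * (\<integral>\<^sup>+ z. ennreal (cmod (f z) powr p) \<partial>weighted_area \<alpha>)"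
  shows "bergman_norm p \<alpha> g \<le> ennreal C * bergman_norm p \<alpha> f"
proof -
  define I where "I = (\<integral>\<^sup>+ z. ennreal (cmod (f z) powr p) \<partial>weighted_area \<alpha>)"
  define J where "J = (\<integral>\<^sup>+ z. ennreal (cmod (g z) powr p) \<partial>weighted_area \<alpha>)"
  have JI: "J \<le> ennreal (C powr p) * I" using le by (simp add: I_def J_def)
  show ?thesis
  proof (cases "I = \<infinity>")
    case True
    then have "bergman_norm p \<alpha> f = \<infinity>" by (simp add: bergman_norm_def I_def[symmetric])
    with C show ?thesis by (simp add: ennreal_mult_top)
  next
    case False
    then obtain i where i: "i \<ge> 0" "I = ennreal i" by (cases I) auto
    with JI have J_le: "J \<le> ennreal (C powr p * i)" by (simp add: ennreal_mult')
    then have "J \<noteq> \<infinity>" by (auto simp: top_unique)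
    then obtain j where j: "j \<ge> 0" "J = ennreal j" by (cases J) auto
    have "j \<le> C powr p * i" using J_le i j by (simp add: j)
    then have "j powr (1 / p) \<le> (C powr p * i) powr (1 / p)"
      using j p by (intro powr_mono2) auto
    also have "\<dots> = C * i powr (1 / p)"
      using i C p by (simp add: powr_mult powr_powr)
    finally show ?thesis
      using i j C by (simp add: bergman_norm_def Let_def I_def[symmetric] J_def[symmetric]
          ennreal_mult'[symmetric] ennreal_leI)
  qed
qed

lemma bergman_projection_norm_le:
  fixes \<alpha> p q :: real
  assumes \<alpha>: "\<alpha> > -1" and p: "p > 1" and q: "q = p / (p - 1)"
  shows "bergman_projection_norm p \<alpha> \<le> ennreal ((1 + \<alpha>) *
    (Gamma ((1 + \<alpha>) / p) * Gamma ((1 + \<alpha>) / q) / (Gamma ((2 + \<alpha>) / 2))\<^sup>2))" (is "_ \<le> ennreal ?C")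
  unfolding bergman_projection_norm_def
proof (rule SUP_least)
  fix f assume f: "f \<in> {f \<in> weighted_Lp p \<alpha>. \<not> (AE z in weighted_area \<alpha>. f z = 0)}"
  have C: "?C > 0"
    using \<alpha> p conjugate_exponent(1)[OF p q]
    by (intro mult_pos_pos divide_pos_pos zero_less_power Gamma_real_pos) auto
  have le: "bergman_norm p \<alpha> (bergman_projection \<alpha> f) \<le> ennreal ?C * bergman_norm p \<alpha> f"
    using f p C nn_integral_bergman_projection_le[OF \<alpha> p q, of f]
    by (intro bergman_norm_le_mult) (auto simp: weighted_Lp_def)
  show "bergman_norm p \<alpha> (bergman_projection \<alpha> f) / bergman_norm p \<alpha> f \<le> ennreal ?C"
  proof (cases "bergman_norm p \<alpha> f = 0")
    case True
    then show ?thesis using le by simp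
  next
    case False
    have "bergman_norm p \<alpha> (bergman_projection \<alpha> f) / bergman_norm p \<alpha> f \<le>
        ennreal ?C * bergman_norm p \<alpha> f / bergman_norm p \<alpha> f"
      by (rule divide_right_mono_ennreal[OF le])
    also have "\<dots> = ennreal ?C"
      using False f by (intro ennreal_mult_divide_eq) (auto simp: weighted_Lp_def)
    finally show ?thesis .
  qed
qed

section \<open>Integrals of products of powers\<close>

text \<open>The power is continuous off the branch cut, and on the cut it is given by an explicit
  formula in the real part. The cut is a Borel set, so the two pieces glue.\<close>

lemma borel_measurable_complex_powr_of_real [measurable (raw)]:
  assumes "f \<in> borel_measurable M"
  shows "(\<lambda>x. (f x :: complex) powr of_real r) \<in> borel_measurable M"
proof -
  define G where "G z = (if Re z < 0 then of_real (\<bar>Re z\<bar> powr r) * exp (\<i> * pi * r)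
    else complex_of_real (Re z powr r))" for z :: complex
  have G: "z powr of_real r = G z" if "z \<in> \<real>\<^sub>\<le>\<^sub>0" for z
    using that powr_of_real_if[of "Re z" r] by (auto simp: G_def elim!: nonpos_Reals_cases)
  have [measurable]: "(\<real>\<^sub>\<le>\<^sub>0 :: complex set) \<in> sets borel" by simp
  have [measurable]: "G \<in> borel_measurable borel" unfolding G_def by measurable
  have [measurable]: "(\<lambda>z::complex. indicator (- \<real>\<^sub>\<le>\<^sub>0) z *\<^sub>R (z powr of_real r)) \<in> borel_measurable borel"
    by (rule borel_measurable_continuous_on_indicator)
       (auto intro!: continuous_intros simp: complex_nonpos_Reals_iff)
  have "(\<lambda>z. if z \<in> \<real>\<^sub>\<le>\<^sub>0 then G z else indicator (- \<real>\<^sub>\<le>\<^sub>0) z *\<^sub>R (z powr of_real r)) \<in> borel_measurable borel"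
    by measurable
  also have "(\<lambda>z. if z \<in> \<real>\<^sub>\<le>\<^sub>0 then G z else indicator (- \<real>\<^sub>\<le>\<^sub>0) z *\<^sub>R (z powr of_real r)) =
      (\<lambda>z. z powr of_real r)"
    using G by auto
  finally show ?thesis by (rule measurable_compose[OF assms])
qed

text \<open>The factorial in the disk moments cancels the one in the binomial coefficient. What
  remains, a quotient of Pochhammer symbols, is a normalized Beta moment, so the disk integral
  collapses to an integral of \<open>H\<close> along a radius.\<close>

lemma integral_weighted_area_holomorphic:
  fixes H :: "complex \<Rightarrow> complex"
  assumes \<alpha>: "\<alpha> > -1" and a: "0 < a" "a < 2 + \<alpha>" and r: "0 < r" "r < 1"
    and H: "H holomorphic_on ball 0 R" and R: "R > 1"
    and [measurable]: "H \<in> borel_measurable borel"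
  shows "(LINT w | weighted_area \<alpha>. (1 - of_real r * w) powr of_real (- a) * H (cnj w)) =
    of_real (1 / Beta a (2 + \<alpha> - a)) * (LINT t | beta_measure a (2 + \<alpha> - a). H (of_real (r * t)))"
proof -
  let ?B = "Beta a (2 + \<alpha> - a)"
  have B: "?B > 0" using a by (simp add: Beta_real_pos)
  define h where "h n = (deriv ^^ n) H 0 / fact n" for n
  have H_sums: "(\<lambda>n. h n * u ^ n) sums H u" if "cmod u < R" for u
    using holomorphic_power_series[OF H, of u] that by (simp add: h_def)
  have h: "summable (\<lambda>n. norm (h n))"
  proof -
    obtain \<rho> where \<rho>: "1 < \<rho>" "\<rho> < R" using R dense by blast
    have "summable (\<lambda>n. h n * of_real \<rho> ^ n)"
      using H_sums[of "of_real \<rho>"] \<rho> by (auto simp: sums_iff)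
    from powser_insidea[OF this, of 1] show ?thesis using \<rho> by simp
  qed
  define A where "A n = complex_of_real (pochhammer a n / fact n) * of_real r ^ n" for n
  have A: "summable (\<lambda>n. norm (A n))"
    unfolding A_def using r a by (intro summable_norm_binomial) auto
  have A_sums: "(\<Sum>n. A n * w ^ n) = (1 - of_real r * w) powr of_real (- a)" if "cmod w < 1" for w
  proof -
    have "cmod (of_real r * w) < 1"
      using r that mult_strict_mono[of r 1 "cmod w" 1] by (simp add: norm_mult)
    from sums_unique[OF sums_binomial_complex[OF this, of a]] show ?thesis
      by (simp add: A_def power_mult_distrib mult.assoc)
  qed
  have "(\<lambda>n. A n * h n * of_real (fact n / pochhammer (2 + \<alpha>) n)) sums
      (LINT w | weighted_area \<alpha>. (\<Sum>n. A n * w ^ n) * (\<Sum>n. h n * cnj w ^ n))"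
    by (rule sums_integral_weighted_area_power_series[OF \<alpha> A h])
  also have "(LINT w | weighted_area \<alpha>. (\<Sum>n. A n * w ^ n) * (\<Sum>n. h n * cnj w ^ n)) =
      (LINT w | weighted_area \<alpha>. (1 - of_real r * w) powr of_real (- a) * H (cnj w))"
    using R by (intro Bochner_Integration.integral_cong) (auto simp: A_sums sums_unique[OF H_sums, symmetric])
  finally have lhs: "(\<lambda>n. A n * h n * of_real (fact n / pochhammer (2 + \<alpha>) n)) sums
      (LINT w | weighted_area \<alpha>. (1 - of_real r * w) powr of_real (- a) * H (cnj w))" .
  have "summable (\<lambda>n. norm (h n * of_real r ^ n))"
    using norm_power_series_term_le[of "of_real r"] r by (intro summable_comparison_test'[OF h]) auto
  from sums_integral_beta_measure_power_series[OF _ _ this, of a "2 + \<alpha> - a"] a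
  have "(\<lambda>n. h n * of_real r ^ n * of_real (?B * pochhammer a n / pochhammer (2 + \<alpha>) n)) sums
      (LINT t | beta_measure a (2 + \<alpha> - a). (\<Sum>n. h n * of_real r ^ n * of_real t ^ n))"
    by simp
  also have "(LINT t | beta_measure a (2 + \<alpha> - a). (\<Sum>n. h n * of_real r ^ n * of_real t ^ n)) =
      (LINT t | beta_measure a (2 + \<alpha> - a). H (of_real (r * t)))"
  proof (rule integral_cong_AE)
    have *: "(\<Sum>n. h n * of_real r ^ n * of_real t ^ n) = H (of_real (r * t))" if "t \<in> {0<..<1}" for t
    proof -
      have "cmod (of_real (r * t)) < R"
        using r that R mult_strict_mono[of r 1 t 1] by (simp add: norm_mult)
      from sums_unique[OF H_sums[OF this]] show ?thesis
        by (simp add: power_mult_distrib mult.assoc)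
    qed
    then show **: "AE t in beta_measure a (2 + \<alpha> - a).
        (\<Sum>n. h n * of_real r ^ n * of_real t ^ n) = H (of_real (r * t))"
      by (rule eventually_mono[OF AE_beta_measure])
  qed simp_all
  finally have "(\<lambda>n. of_real (1 / ?B) * (h n * of_real r ^ n * of_real (?B * pochhammer a n / pochhammer (2 + \<alpha>) n))) sums
      (of_real (1 / ?B) * (LINT t | beta_measure a (2 + \<alpha> - a). H (of_real (r * t))))"
    by (rule sums_mult)
  also have "(\<lambda>n. of_real (1 / ?B) * (h n * of_real r ^ n * of_real (?B * pochhammer a n / pochhammer (2 + \<alpha>) n))) =
      (\<lambda>n. A n * h n * of_real (fact n / pochhammer (2 + \<alpha>) n))"
    using B by (auto simp: A_def field_simps)
  finally show ?thesis using lhs by (rule sums_unique2[rotated])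
qed


text \<open>The dilation appears twice on the right: \<open>r * t\<close> comes from the holomorphic
  factor, and the other r belongs to the antiholomorphic factor evaluated there.\<close>

lemma integral_weighted_area_dilated:
  assumes \<alpha>: "\<alpha> > -1" and a: "0 < a" "a < 2 + \<alpha>" and r: "0 < r" "r < 1" and z: "cmod z < 1"
  shows "(LINT w | weighted_area \<alpha>. (1 - of_real r * w) powr of_real (- a) *
      ((1 - of_real r * cnj w) powr of_real (- b) * (1 - z * cnj w) powr of_real (- c))) =
    of_real (1 / Beta a (2 + \<alpha> - a)) * (LINT t | beta_measure a (2 + \<alpha> - a).
      (1 - of_real r * of_real (r * t)) powr of_real (- b) * (1 - z * of_real (r * t)) powr of_real (- c))"
proof -
  \<comment> \<open>For |u| < 1/m both 1 - ru and 1 - zu have positive real part, so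
    \<open>H\<close> is holomorphic on a disk of radius larger than 1.\<close>
  define m where "m = max r (cmod z)"
  have m: "m > 0" "m < 1" "r \<le> m" "cmod z \<le> m" using r z by (auto simp: m_def)
  define H where "H u = (1 - of_real r * u) powr of_real (- b) * (1 - z * u) powr of_real (- c)" for u
  have nonpos: "1 - v * u \<notin> \<real>\<^sub>\<le>\<^sub>0" if "cmod v \<le> m" "cmod u < 1 / m" for u v
  proof -
    have "cmod (v * u) \<le> m * cmod u" using that m by (simp add: norm_mult mult_right_mono)
    also have "\<dots> < 1" using that m by (simp add: field_simps)
    finally have "Re (1 - v * u) > 0" by (rule Re_one_minus_pos)
    then show ?thesis by (simp add: complex_nonpos_Reals_iff)
  qed
  have "H holomorphic_on ball 0 (1 / m)"
    unfolding H_def using r m by (intro holomorphic_intros nonpos) auto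
  moreover have "H \<in> borel_measurable borel"
    unfolding H_def by measurable
  ultimately show ?thesis
    using integral_weighted_area_holomorphic[OF \<alpha> a r, of H "1 / m"] m by (simp add: H_def)
qed

text \<open>Euler's integral for the hypergeometric function with parameters c, s over c: the Beta
  parameters add up to c, so the Pochhammer symbols of c cancel and a plain binomial series
  remains.\<close>

lemma integral_beta_measure_euler:
  assumes s: "0 < s" "s < c" and z: "cmod z < 1"
  shows "(LINT t | beta_measure s (c - s). (1 - z * of_real t) powr of_real (- c)) =
    of_real (Beta s (c - s)) * (1 - z) powr of_real (- s)"
proof -
  have c: "c > 0" using s by simp
  have "(\<lambda>n. of_real (pochhammer c n / fact n) * z ^ n *
        of_real (Beta s (c - s) * pochhammer s n / pochhammer (s + (c - s)) n)) sums
      (LINT t | beta_measure s (c - s). (\<Sum>n. of_real (pochhammer c n / fact n) * z ^ n * of_real t ^ n))"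
    using s z c by (intro sums_integral_beta_measure_power_series summable_norm_binomial) auto
  also have "(LINT t | beta_measure s (c - s). (\<Sum>n. of_real (pochhammer c n / fact n) * z ^ n * of_real t ^ n)) =
      (LINT t | beta_measure s (c - s). (1 - z * of_real t) powr of_real (- c))"
  proof (rule integral_cong_AE)
    have "(\<Sum>n. of_real (pochhammer c n / fact n) * z ^ n * of_real t ^ n) = (1 - z * of_real t) powr of_real (- c)"
      if "t \<in> {0<..<1}" for t
    proof -
      have "cmod (z * of_real t) < 1"
        using norm_mult_cnj_less_1[OF z, of "of_real t"] that by simp
      from sums_unique[OF sums_binomial_complex[OF this, of c]] show ?thesis
        by (simp add: power_mult_distrib mult.assoc)
    qed
    then show "AE t in beta_measure s (c - s). (\<Sum>n. of_real (pochhammer c n / fact n) * z ^ n * of_real t ^ n) =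
        (1 - z * of_real t) powr of_real (- c)"
      by (rule eventually_mono[OF AE_beta_measure])
  qed measurable
  also have "(\<lambda>n. of_real (pochhammer c n / fact n) * z ^ n *
        of_real (Beta s (c - s) * pochhammer s n / pochhammer (s + (c - s)) n)) =
      (\<lambda>n. of_real (Beta s (c - s)) * (of_real (pochhammer s n / fact n) * z ^ n))"
    using pochhammer_pos[OF c] by (auto simp: field_simps less_imp_neq[symmetric])
  finally show ?thesis
    using sums_mult[OF sums_binomial_complex[OF z, of s]] by (rule sums_unique2)
qed

text \<open>From 1 - w = (1 - rw) - (1 - r)w, where the last term is at most 1 - r and hence at most
  |1 - rw|. The constant 2 is independent of r, which provides the dominating function for r
  \<rightarrow> 1.\<close>

lemma norm_one_minus_dilate:
  assumes "0 \<le> r" "r < 1" "cmod w < 1"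
  shows "cmod (1 - w) \<le> 2 * cmod (1 - of_real r * w)"
proof -
  have "cmod (1 - w) \<le> cmod (1 - of_real r * w) + cmod (of_real (1 - r) * w)"
    using norm_triangle_ineq4[of "1 - of_real r * w" "of_real (1 - r) * w"] by (simp add: algebra_simps)
  moreover have "cmod (of_real (1 - r) * w) \<le> 1 - r"
    unfolding norm_mult norm_of_real using assms by (simp add: mult_left_le)
  moreover have "1 - r \<le> cmod (1 - of_real r * w)"
    using one_minus_norm_le[of "cnj w" "of_real r"] assms by simp
  ultimately show ?thesis by linarith
qed

lemma
  fixes f :: "real \<Rightarrow> 'a::{banach, second_countable_topology}"
  assumes [measurable]: "f \<in> borel_measurable borel"
  shows integral_beta_measure_tilt_right:
    "(LINT t | beta_measure a b. (1 - t) powr y *\<^sub>R f t) = (LINT t | beta_measure a (b + y). f t)"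
    and integrable_beta_measure_tilt_right:
    "integrable (beta_measure a b) (\<lambda>t. (1 - t) powr y *\<^sub>R f t) \<longleftrightarrow> integrable (beta_measure a (b + y)) f"
    and integral_beta_measure_tilt_left:
    "(LINT t | beta_measure a b. t powr y *\<^sub>R f t) = (LINT t | beta_measure (a + y) b. f t)"
proof -
  \<comment> \<open>Only almost everywhere, because \<open>0 powr 0\<close> is 0.\<close>
  have r: "AE t in beta_measure a b. (t powr 0 * (1 - t) powr y) *\<^sub>R f t = (1 - t) powr y *\<^sub>R f t"
    by (rule eventually_mono[OF AE_beta_measure]) auto
  have l: "AE t in beta_measure a b. (t powr y * (1 - t) powr 0) *\<^sub>R f t = t powr y *\<^sub>R f t"
    by (rule eventually_mono[OF AE_beta_measure]) auto
  show "(LINT t | beta_measure a b. (1 - t) powr y *\<^sub>R f t) = (LINT t | beta_measure a (b + y). f t)"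
    using integral_beta_measure_tilt[of f a b 0 y] integral_cong_AE[OF _ _ r] by simp
  show "integrable (beta_measure a b) (\<lambda>t. (1 - t) powr y *\<^sub>R f t) \<longleftrightarrow> integrable (beta_measure a (b + y)) f"
    using integrable_beta_measure_tilt[of f a b 0 y] integrable_cong_AE[OF _ _ r] by simp
  show "(LINT t | beta_measure a b. t powr y *\<^sub>R f t) = (LINT t | beta_measure (a + y) b. f t)"
    using integral_beta_measure_tilt[of f a b y 0] integral_cong_AE[OF _ _ l] by simp
qed

text \<open>A sequence of radii, as Fatou's lemma and dominated convergence require; the shift by 2
  keeps the first term positive.\<close>

definition dilation :: "nat \<Rightarrow> real" where
  "dilation n = 1 - 1 / (real n + 2)"

lemma dilation: "0 < dilation n" "dilation n < 1"
  by (auto simp: dilation_def field_simps)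

lemma dilation_tendsto: "dilation \<longlonglongrightarrow> 1"
proof -
  have "(\<lambda>n. 1 - 1 / (real n + 2)) \<longlonglongrightarrow> 1 - 0"
    by (intro tendsto_intros tendsto_divide_0[OF tendsto_const] filterlim_at_top_imp_at_infinity
        filterlim_tendsto_add_at_top[OF tendsto_const, of _ _ 2, unfolded add.commute[of 2]]
        filterlim_real_sequentially)
  then show ?thesis by (simp add: dilation_def[abs_def])
qed

text \<open>Fatou's lemma along the dilations. The dilated integrals are evaluated by splitting the
  exponent evenly between 1 - rw and its conjugate; the kernel factor of the general formula is made
  trivial by z = 0 and exponent 0.\<close>

lemma integrable_norm_one_minus_powr:
  assumes \<alpha>: "\<alpha> > -1" and s: "0 < s" "s < 2 + \<alpha>"
  shows "integrable (weighted_area \<alpha>) (\<lambda>w. cmod (1 - w) powr (- s))"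
proof -
  interpret finite_measure "weighted_area \<alpha>"
    using \<alpha> by (rule finite_measure_weighted_area)
  define l where "l = s / 2"
  have l: "0 < l" "l < 2 + \<alpha>" using s by (auto simp: l_def)
  have ls: "2 + \<alpha> - l + - l = 2 + \<alpha> - s" by (simp add: l_def)
  \<comment> \<open>The Beta integral with 1 - t in place of 1 - r^2 t: the factor (1-t)^(-l) lowers
    the second parameter to 2+\<alpha>-s, positive by the bound on s.\<close>
  define C where "C = 1 / Beta l (2 + \<alpha> - l) * Beta l (2 + \<alpha> - s)"
  interpret b: finite_measure "beta_measure l (2 + \<alpha> - s)"
    using l s by (intro finite_measure_beta_measure) auto
  have nn_le: "(\<integral>\<^sup>+ w. ennreal (cmod (1 - of_real r * w) powr (- s)) \<partial>weighted_area \<alpha>) \<le> ennreal C"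
    if r: "0 < r" "r < 1" for r
  proof -
    define F where "F w = cmod (1 - of_real r * w) powr (- s)" for w
    have [measurable]: "F \<in> borel_measurable borel" unfolding F_def by measurable
    have intF: "integrable (weighted_area \<alpha>) F"
    proof (rule integrable_const_bound)
      have "F w \<le> (1 - r) powr (- s)" if "cmod w < 1" for w
        unfolding F_def using r s that one_minus_norm_le[of "cnj w" "of_real r"]
        by (intro powr_mono2') auto
      then show "AE w in weighted_area \<alpha>. norm (F w) \<le> (1 - r) powr (- s)"
        by (intro AE_I2) (auto simp: F_def)
    qed simp
    have "complex_of_real (LINT w | weighted_area \<alpha>. F w) = (LINT w | weighted_area \<alpha>. of_real (F w))"
      by simp
    also have "\<dots> = (LINT w | weighted_area \<alpha>. (1 - of_real r * w) powr of_real (- l) *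
      ((1 - of_real r * cnj w) powr of_real (- l) * (1 - 0 * cnj w) powr of_real (- 0)))"
    proof (rule Bochner_Integration.integral_cong)
      fix w assume "w \<in> space (weighted_area \<alpha>)"
      then have "cmod (of_real r * w) < 1"
        using norm_mult_cnj_less_1[of "of_real r" "cnj w"] r by simp
      then have "(1 - of_real r * cnj w) powr of_real (- l) = cnj ((1 - of_real r * w) powr of_real (- l))"
        using cnj_powr_of_real[OF Re_one_minus_pos, of "of_real r * w" "- l"] by simp
      then have "(1 - of_real r * w) powr of_real (- l) * (1 - of_real r * cnj w) powr of_real (- l) =
          of_real ((cmod ((1 - of_real r * w) powr of_real (- l)))\<^sup>2)"
        by (simp only: complex_norm_square)
      also have "(cmod ((1 - of_real r * w) powr of_real (- l)))\<^sup>2 = F w"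
        unfolding norm_powr_of_real power2_eq_square powr_add[symmetric] F_def
        by (rule arg_cong[where f = "(powr) _"]) (simp add: l_def)
      finally show "of_real (F w) = (1 - of_real r * w) powr of_real (- l) *
          ((1 - of_real r * cnj w) powr of_real (- l) * (1 - 0 * cnj w) powr of_real (- 0))"
        by simp
    qed simp
    also have "\<dots> = of_real (1 / Beta l (2 + \<alpha> - l)) * (LINT t | beta_measure l (2 + \<alpha> - l).
      (1 - of_real r * of_real (r * t)) powr of_real (- l) * (1 - 0 * of_real (r * t)) powr of_real (- 0))"
      using \<alpha> l r by (intro integral_weighted_area_dilated) auto
    also have "(LINT t | beta_measure l (2 + \<alpha> - l).
      (1 - of_real r * of_real (r * t)) powr of_real (- l) * (1 - 0 * of_real (r * t)) powr of_real (- 0)) =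
      (LINT t | beta_measure l (2 + \<alpha> - l). complex_of_real ((1 - r * (r * t)) powr (- l)))"
    proof (rule integral_cong_AE)
      have "(1 - of_real r * of_real (r * t)) powr of_real (- l) * (1 - 0 * of_real (r * t)) powr of_real (- 0) =
        complex_of_real ((1 - r * (r * t)) powr (- l))" if "t \<in> {0<..<1}" for t
      proof -
        have "r * (r * t) \<le> 1" using r that by (intro mult_le_one) auto
        then show ?thesis using powr_of_real[of "1 - r * (r * t)" "- l"] by simp
      qed
      then show "AE t in beta_measure l (2 + \<alpha> - l). (1 - of_real r * of_real (r * t)) powr of_real (- l) *
          (1 - 0 * of_real (r * t)) powr of_real (- 0) = complex_of_real ((1 - r * (r * t)) powr (- l))"
        by (rule eventually_mono[OF AE_beta_measure])
    qed measurable
    finally have "(LINT w | weighted_area \<alpha>. F w) = 1 / Beta l (2 + \<alpha> - l) *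
        (LINT t | beta_measure l (2 + \<alpha> - l). (1 - r * (r * t)) powr (- l))"
      by (simp only: integral_complex_of_real of_real_mult[symmetric] of_real_eq_iff)
    also have "\<dots> \<le> C"
    proof -
      have "(LINT t | beta_measure l (2 + \<alpha> - l). (1 - r * (r * t)) powr (- l)) \<le>
          (LINT t | beta_measure l (2 + \<alpha> - l). (1 - t) powr (- l) *\<^sub>R 1)"
      proof (rule integral_mono_AE')
        show "integrable (beta_measure l (2 + \<alpha> - l)) (\<lambda>t. (1 - t) powr (- l) *\<^sub>R (1::real))"
          using b.integrable_const[of "1::real"] unfolding integrable_beta_measure_tilt_right[OF borel_measurable_const] ls .
        have "(1 - r * (r * t)) powr (- l) \<le> (1 - t) powr (- l) *\<^sub>R 1" if "t \<in> {0<..<1}" for t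
        proof -
          have "r * (r * t) \<le> 1 * (1 * t)" using r that by (intro mult_mono) auto
          then show ?thesis using l that by (auto intro!: powr_mono2')
        qed
        then show "AE t in beta_measure l (2 + \<alpha> - l). (1 - r * (r * t)) powr (- l) \<le> (1 - t) powr (- l) *\<^sub>R 1"
          by (rule eventually_mono[OF AE_beta_measure])
      qed simp
      also have "\<dots> = Beta l (2 + \<alpha> - s)"
        unfolding integral_beta_measure_tilt_right[OF borel_measurable_const] ls
        using l s by (simp add: measure_beta_measure)
      finally show ?thesis
        using l unfolding C_def by (intro mult_left_mono) (auto intro!: less_imp_le Beta_real_pos)
    qed
    finally have "(LINT w | weighted_area \<alpha>. F w) \<le> C" .
    then have "ennreal (LINT w | weighted_area \<alpha>. F w) \<le> ennreal C" by (rule ennreal_leI)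
    moreover have "(\<integral>\<^sup>+ w. ennreal (F w) \<partial>weighted_area \<alpha>) = ennreal (LINT w | weighted_area \<alpha>. F w)"
      by (rule nn_integral_eq_integral[OF intF]) (simp add: F_def)
    ultimately show ?thesis by (simp only: F_def)
  qed
  have "(\<integral>\<^sup>+ w. ennreal (cmod (1 - w) powr (- s)) \<partial>weighted_area \<alpha>) =
      (\<integral>\<^sup>+ w. liminf (\<lambda>n. ennreal (cmod (1 - of_real (dilation n) * w) powr (- s))) \<partial>weighted_area \<alpha>)"
  proof (rule nn_integral_cong)
    fix w assume "w \<in> space (weighted_area \<alpha>)"
    then have "w \<noteq> 1" by auto
    then have *: "(\<lambda>n. ennreal (cmod (1 - of_real (dilation n) * w) powr (- s))) \<longlonglongrightarrow>
        ennreal (cmod (1 - of_real 1 * w) powr (- s))"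
      by (intro tendsto_intros dilation_tendsto tendsto_ennrealI) auto
    show "ennreal (cmod (1 - w) powr (- s)) =
        liminf (\<lambda>n. ennreal (cmod (1 - of_real (dilation n) * w) powr (- s)))"
      using lim_imp_Liminf[OF _ *] by simp
  qed
  also have "\<dots> \<le> liminf (\<lambda>n. \<integral>\<^sup>+ w. ennreal (cmod (1 - of_real (dilation n) * w) powr (- s)) \<partial>weighted_area \<alpha>)"
    by (rule nn_integral_liminf) measurable
  also have "\<dots> \<le> liminf (\<lambda>n. ennreal C)"
    by (intro Liminf_mono always_eventually allI nn_le dilation)
  also have "\<dots> < \<infinity>" by (simp add: Liminf_const)
  finally show ?thesis by (intro integrableI_bounded) auto
qed

text \<open>Both sides of the dilated identity converge as r \<rightarrow> 1 by dominated
  convergence. Individually b may be negative; the modulus in the disk depends only on a + b, and in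
  the limit (1-t)^(-b) is absorbed into the Beta parameter.\<close>

lemma integral_weighted_area_powr:
  assumes \<alpha>: "\<alpha> > -1" and a: "0 < a" "a < 2 + \<alpha>" and s: "0 < a + b" "a + b < 2 + \<alpha>" and z: "cmod z < 1"
    and c: "c \<ge> 0"
  shows "(LINT w | weighted_area \<alpha>. (1 - w) powr of_real (- a) *
      ((1 - cnj w) powr of_real (- b) * (1 - z * cnj w) powr of_real (- c))) =
    of_real (1 / Beta a (2 + \<alpha> - a)) *
      (LINT t | beta_measure a (2 + \<alpha> - (a + b)). (1 - z * of_real t) powr of_real (- c))"
proof -
  define g where "g r w = (1 - of_real r * w) powr of_real (- a) *
      ((1 - of_real r * cnj w) powr of_real (- b) * (1 - z * cnj w) powr of_real (- c))" for r :: real and w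
  define k where "k r t = (1 - of_real r * of_real (r * t)) powr of_real (- b) *
      (1 - z * of_real (r * t)) powr of_real (- c)" for r t :: real
  let ?B = "beta_measure a (2 + \<alpha> - a)"
  interpret b: finite_measure ?B
    using a by (intro finite_measure_beta_measure) auto
  interpret b': finite_measure "beta_measure a (2 + \<alpha> - (a + b))"
    using a s by (intro finite_measure_beta_measure) auto
  have [measurable]: "g r \<in> borel_measurable (weighted_area \<alpha>)" "k r \<in> borel_measurable borel" for r
    unfolding g_def k_def by measurable
  have Re_pos: "Re (1 - u * v) > 0" if "cmod u \<le> 1" "cmod v < 1" for u v
    using norm_mult_cnj_less_1[of v "cnj u"] that by (intro Re_one_minus_pos) (simp add: mult.commute)
  have norm_z: "cmod ((1 - z * v) powr of_real (- c)) \<le> (1 - cmod z) powr (- c)" if "cmod v \<le> 1" for v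
    unfolding norm_powr_of_real using one_minus_norm_le[of "cnj v" z] that z c
    by (intro powr_mono2') auto
  have "(\<lambda>n. LINT w | weighted_area \<alpha>. g (dilation n) w) \<longlonglongrightarrow> (LINT w | weighted_area \<alpha>. g 1 w)"
  proof (rule integral_dominated_convergence)
    \<comment> \<open>The factor \<open>2 powr (a + b)\<close> pays for replacing |1 - rw| by |1 -
      w|; the kernel is bounded for fixed z.\<close>
    show "integrable (weighted_area \<alpha>) (\<lambda>w. 2 powr (a + b) * (1 - cmod z) powr (- c) * cmod (1 - w) powr (- (a + b)))"
      using integrable_norm_one_minus_powr[OF \<alpha> s] by (rule integrable_mult_right)
    show "AE w in weighted_area \<alpha>. (\<lambda>n. g (dilation n) w) \<longlonglongrightarrow> g 1 w"
    proof (rule AE_I2)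
      fix w assume "w \<in> space (weighted_area \<alpha>)"
      then have w: "cmod w < 1" by simp
      show "(\<lambda>n. g (dilation n) w) \<longlonglongrightarrow> g 1 w"
        unfolding g_def
        using Re_pos[of 1 w] Re_pos[of 1 "cnj w"] w
        by (intro tendsto_intros tendsto_powr_complex dilation_tendsto) (auto simp: complex_nonpos_Reals_iff)
    qed
    show "AE w in weighted_area \<alpha>. norm (g (dilation n) w) \<le>
        2 powr (a + b) * (1 - cmod z) powr (- c) * cmod (1 - w) powr (- (a + b))" for n
    proof (rule AE_I2)
      fix w assume "w \<in> space (weighted_area \<alpha>)"
      then have w: "cmod w < 1" by simp
      define r where "r = dilation n"
      have r: "0 < r" "r < 1" unfolding r_def by (rule dilation)+
      have eq: "cmod (1 - of_real r * cnj w) = cmod (1 - of_real r * w)"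
        using complex_mod_cnj[of "1 - of_real r * w"] by simp
      have pos: "cmod (1 - w) > 0" using w by auto
      have le: "cmod (1 - w) / 2 \<le> cmod (1 - of_real r * w)"
        using norm_one_minus_dilate[of r w] r w by simp
      have "norm (g r w) = cmod (1 - of_real r * w) powr (- (a + b)) * cmod ((1 - z * cnj w) powr of_real (- c))"
        unfolding g_def norm_mult norm_powr_of_real eq mult.assoc[symmetric] powr_add[symmetric] by simp
      also have "\<dots> \<le> (cmod (1 - w) / 2) powr (- (a + b)) * (1 - cmod z) powr (- c)"
        using le s pos w norm_z[of "cnj w"] by (intro mult_mono powr_mono2') auto
      also have "(cmod (1 - w) / 2) powr (- (a + b)) = 2 powr (a + b) * cmod (1 - w) powr (- (a + b))"
        by (subst powr_divide) (simp_all only: powr_minus[of 2], simp_all add: field_simps)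
      finally show "norm (g (dilation n) w) \<le>
          2 powr (a + b) * (1 - cmod z) powr (- c) * cmod (1 - w) powr (- (a + b))"
        by (simp add: r_def mult_ac)
    qed
  qed measurable
  moreover have "(\<lambda>n. LINT w | weighted_area \<alpha>. g (dilation n) w) \<longlonglongrightarrow>
      of_real (1 / Beta a (2 + \<alpha> - a)) * (LINT t | ?B. k 1 t)"
  proof -
    have eq: "(LINT w | weighted_area \<alpha>. g r w) = of_real (1 / Beta a (2 + \<alpha> - a)) * (LINT t | ?B. k r t)"
      if "0 < r" "r < 1" for r
      unfolding g_def k_def by (rule integral_weighted_area_dilated[OF \<alpha> a that z])
    have "(\<lambda>n. LINT t | ?B. k (dilation n) t) \<longlonglongrightarrow> (LINT t | ?B. k 1 t)"
    proof (rule integral_dominated_convergence)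
      \<comment> \<open>The two summands cover the two signs of b: for negative b the factor is at
        most 1, otherwise it is at most (1-t)^(-b).\<close>
      show "integrable ?B (\<lambda>t. (1 + (1 - t) powr (- b) *\<^sub>R 1) * (1 - cmod z) powr (- c))"
        using b'.integrable_const[of "1::real"]
        by (intro integrable_mult_left Bochner_Integration.integrable_add b.integrable_const)
           (subst integrable_beta_measure_tilt_right, auto simp: algebra_simps)
      show "AE t in ?B. (\<lambda>n. k (dilation n) t) \<longlonglongrightarrow> k 1 t"
      proof (rule eventually_mono[OF AE_beta_measure])
        fix t :: real assume t: "t \<in> {0<..<1}"
        show "(\<lambda>n. k (dilation n) t) \<longlonglongrightarrow> k 1 t"
          unfolding k_def using Re_pos[of "of_real t" z] z t
          by (intro tendsto_intros tendsto_powr_complex dilation_tendsto)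
             (auto simp: complex_nonpos_Reals_iff mult.commute)
      qed
      show "AE t in ?B. norm (k (dilation n) t) \<le> (1 + (1 - t) powr (- b) *\<^sub>R 1) * (1 - cmod z) powr (- c)" for n
      proof (rule eventually_mono[OF AE_beta_measure])
        fix t :: real assume t: "t \<in> {0<..<1}"
        define r where "r = dilation n"
        have r: "0 < r" "r < 1" unfolding r_def by (rule dilation)+
        have "r * (r * t) \<le> 1 * (1 * t)" using r t by (intro mult_mono) auto
        then have rt: "r * (r * t) \<le> t" "r * (r * t) \<le> 1" using t by (simp_all only: mult_1 greaterThanLessThan_iff) linarith+
        have rt0: "0 \<le> r * (r * t)" using r t by auto
        have rt1: "cmod (of_real (r * t)) \<le> 1" 
          using r t mult_le_one[of r t] by (simp add: norm_mult)
        have "(1 - r * (r * t)) powr (- b) \<le> 1 + (1 - t) powr (- b)"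
        proof (cases "b \<ge> 0")
          case True
          then have "(1 - r * (r * t)) powr (- b) \<le> (1 - t) powr (- b)"
            using rt t by (intro powr_mono2') auto
          then show ?thesis by simp
        next
          case False
          then have "(1 - r * (r * t)) powr (- b) \<le> 1 powr (- b)"
            using rt(2) rt0 by (intro powr_mono2) auto
          then show ?thesis by (simp add: add_increasing2)
        qed
        moreover have "cmod (1 - of_real r * of_real (r * t)) = 1 - r * (r * t)"
          using rt t norm_of_real[of "1 - r * (r * t)", where 'a = complex] by simp
        ultimately have "norm (k r t) \<le> (1 + (1 - t) powr (- b)) * (1 - cmod z) powr (- c)"
          unfolding k_def norm_mult norm_powr_of_real[of "1 - of_real r * of_real (r * t)"]
          by (intro mult_mono norm_z rt1) auto
        then show "norm (k (dilation n) t) \<le> (1 + (1 - t) powr (- b) *\<^sub>R 1) * (1 - cmod z) powr (- c)"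
          by (simp add: r_def)
      qed
    qed measurable
    from tendsto_mult_left[OF this, of "of_real (1 / Beta a (2 + \<alpha> - a))"] show ?thesis
      by (simp only: eq[OF dilation])
  qed
  ultimately have "(LINT w | weighted_area \<alpha>. g 1 w) = of_real (1 / Beta a (2 + \<alpha> - a)) * (LINT t | ?B. k 1 t)"
    by (rule LIMSEQ_unique)
  moreover have "(LINT t | ?B. k 1 t) =
      (LINT t | beta_measure a (2 + \<alpha> - (a + b)). (1 - z * of_real t) powr of_real (- c))"
  proof -
    have "(LINT t | ?B. k 1 t) = (LINT t | ?B. (1 - t) powr (- b) *\<^sub>R (1 - z * of_real t) powr of_real (- c))"
    proof (rule integral_cong_AE)
      show "AE t in ?B. k 1 t = (1 - t) powr (- b) *\<^sub>R (1 - z * of_real t) powr of_real (- c)"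
      proof (rule eventually_mono[OF AE_beta_measure])
        fix t :: real assume "t \<in> {0<..<1}"
        then show "k 1 t = (1 - t) powr (- b) *\<^sub>R (1 - z * of_real t) powr of_real (- c)"
          using powr_of_real[of "1 - t" "- b"] by (simp add: k_def scaleR_conv_of_real)
      qed
    qed measurable
    then show ?thesis
      by (subst (asm) integral_beta_measure_tilt_right) (simp_all add: algebra_simps)
  qed
  ultimately show ?thesis by (simp add: g_def)
qed

section \<open>The lower bound\<close>

text \<open>Both powers lie between t^D and 1, an interval of length at most D(1-t) by Bernoulli's
  inequality. The bound is uniform in the exponents.\<close>

lemma abs_powr_diff_le:
  fixes t x y D :: real
  assumes t: "0 < t" "t < 1" and D: "D \<ge> 1" and x: "0 \<le> x" "x \<le> D" and y: "0 \<le> y" "y \<le> D"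
  shows "\<bar>t powr x - t powr y\<bar> \<le> D * (1 - t)"
proof -
  have range: "t powr D \<le> t powr u" "t powr u \<le> 1" if "0 \<le> u" "u \<le> D" for u
    using that t powr_mono'[of u D t] powr_mono'[of 0 u t] by auto
  \<comment> \<open>Bernoulli's inequality as weighted AM-GM of t^D and 1; D \<ge> 1 keeps the
    weights nonnegative.\<close>
  have "(t powr D) powr (1 / D) * 1 powr (1 - 1 / D) \<le> 1 / D * t powr D + (1 - 1 / D) * 1"
    using t D by (intro Youngs_inequality_0) auto
  then have "t \<le> 1 / D * t powr D + (1 - 1 / D)"
    using t D by (simp add: powr_powr)
  then have "D * t \<le> D * (1 / D * t powr D + (1 - 1 / D))"
    using D by (intro mult_left_mono) auto
  then have "D * t \<le> t powr D + D - 1"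
    using D by (simp add: distrib_left right_diff_distrib)
  then have "1 - t powr D \<le> D * (1 - t)"
    by (simp add: right_diff_distrib)
  then show ?thesis using range[OF x] range[OF y] by linarith
qed

text \<open>Convexity applied to x + y as the combination of x/(1-\<epsilon>) and y/\<epsilon>. It
  acts as a pointwise substitute for Minkowski's inequality: the factor of x^p tends to 1 as
  \<epsilon> \<rightarrow> 0, at the price of a large factor on y^p.\<close>

lemma powr_add_le:
  fixes x y p \<epsilon> :: real
  assumes x: "x \<ge> 0" and y: "y > 0" and p: "p > 1" and \<epsilon>: "0 < \<epsilon>" "\<epsilon> < 1"
  shows "(x + y) powr p \<le> (1 - \<epsilon>) powr (1 - p) * x powr p + \<epsilon> powr (1 - p) * y powr p"
proof (cases "x = 0")
  case True
  have "1 \<le> \<epsilon> powr (1 - p)" using \<epsilon> p powr_mono'[of "1 - p" 0 \<epsilon>] by simp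
  then have "1 * y powr p \<le> \<epsilon> powr (1 - p) * y powr p" by (intro mult_right_mono) auto
  with True show ?thesis using p by simp
next
  case False
  have eq: "\<delta> * (u / \<delta>) powr p = \<delta> powr (1 - p) * u powr p" if "\<delta> > 0" "u > 0" for \<delta> u :: real
    using that by (simp add: powr_divide powr_diff)
  have "((1 - \<epsilon>) *\<^sub>R (x / (1 - \<epsilon>)) + \<epsilon> *\<^sub>R (y / \<epsilon>)) powr p \<le>
      (1 - \<epsilon>) * (x / (1 - \<epsilon>)) powr p + \<epsilon> * (y / \<epsilon>) powr p"
    using powr_convex[of p] p \<epsilon> x y False by (intro convex_onD[of "{0<..}" "\<lambda>x. x powr p"]) auto
  then show ?thesis
    using eq[of "1 - \<epsilon>" x] eq[of \<epsilon> y] \<epsilon> x y False by simp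
qed

text \<open>The total exponent \<open>s\<close> fixes the modulus, and \<open>a\<close> is its
  holomorphic share; only the latter enters the Beta value in the denominator of the projection
  formula.\<close>

definition test_function :: "real \<Rightarrow> real \<Rightarrow> complex \<Rightarrow> complex" where
  "test_function a s w = (1 - w) powr of_real (- a) * (1 - cnj w) powr of_real (- (s - a))"

lemma borel_measurable_test_function [measurable]: "test_function a s \<in> borel_measurable borel"
  unfolding test_function_def by measurable

lemma norm_test_function: "cmod (test_function a s w) = cmod (1 - w) powr (- s)"
proof -
  have "cmod (1 - cnj w) = cmod (1 - w)"
    using complex_mod_cnj[of "1 - w"] by simp
  then show ?thesis
    unfolding test_function_def norm_mult norm_powr_of_real by (simp add: powr_add[symmetric])
qed

lemma bergman_projection_test_function:
  assumes \<alpha>: "\<alpha> > -1" and a: "0 < a" "a < 2 + \<alpha>" and s: "0 < s" "s < 2 + \<alpha>" and z: "cmod z < 1"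
  shows "bergman_projection \<alpha> (test_function a s) z = of_real (1 / Beta a (2 + \<alpha> - a)) *
    (LINT t | beta_measure a (2 + \<alpha> - s). (1 - z * of_real t) powr of_real (- (2 + \<alpha>)))"
proof -
  have "u / v powr of_real (2 + \<alpha>) = u * v powr of_real (- (2 + \<alpha>))" for u v :: complex
    unfolding of_real_minus powr_minus by (rule divide_inverse)
  then have "bergman_projection \<alpha> (test_function a s) z =
     (LINT w | weighted_area \<alpha>. (1 - w) powr of_real (- a) *
      ((1 - cnj w) powr of_real (- (s - a)) * (1 - z * cnj w) powr of_real (- (2 + \<alpha>))))"
    unfolding bergman_projection_def test_function_def by (simp only: mult.assoc)
  also have "\<dots> = of_real (1 / Beta a (2 + \<alpha> - a)) *
      (LINT t | beta_measure a (2 + \<alpha> - (a + (s - a))). (1 - z * of_real t) powr of_real (- (2 + \<alpha>)))"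
    using \<alpha> a s z by (intro integral_weighted_area_powr) auto
  finally show ?thesis by simp
qed

text \<open>The even splitting of the exponent again, now without dilation. The factor
  \<open>Gamma (2 + \<alpha> - s)\<close> makes the integral blow up as s approaches 2+\<alpha>, and
  so drives the norms of the test functions to infinity.\<close>

lemma integral_norm_one_minus_powr:
  assumes \<alpha>: "\<alpha> > -1" and s: "0 < s" "s < 2 + \<alpha>"
  shows "(LINT w | weighted_area \<alpha>. cmod (1 - w) powr (- s)) =
    Gamma (2 + \<alpha>) * Gamma (2 + \<alpha> - s) / (Gamma (2 + \<alpha> - s / 2))\<^sup>2"
proof -
  define l where "l = s / 2"
  have l: "0 < l" "l < 2 + \<alpha>" using s by (auto simp: l_def)
  have "complex_of_real (LINT w | weighted_area \<alpha>. cmod (1 - w) powr (- s)) =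
      (LINT w | weighted_area \<alpha>. of_real (cmod (1 - w) powr (- s)))"
    by simp
  also have "\<dots> = (LINT w | weighted_area \<alpha>. (1 - w) powr of_real (- l) *
      ((1 - cnj w) powr of_real (- l) * (1 - 0 * cnj w) powr of_real (- 0)))"
  proof (rule Bochner_Integration.integral_cong)
    fix w assume "w \<in> space (weighted_area \<alpha>)"
    then have "(1 - cnj w) powr of_real (- l) = cnj ((1 - w) powr of_real (- l))"
      using cnj_powr_of_real[OF Re_one_minus_pos, of w "- l"] by simp
    then have "(1 - w) powr of_real (- l) * (1 - cnj w) powr of_real (- l) =
        of_real ((cmod ((1 - w) powr of_real (- l)))\<^sup>2)"
      by (simp only: complex_norm_square)
    also have "(cmod ((1 - w) powr of_real (- l)))\<^sup>2 = cmod (1 - w) powr (- s)"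
      unfolding norm_powr_of_real power2_eq_square powr_add[symmetric]
      by (rule arg_cong[where f = "(powr) _"]) (simp add: l_def)
    finally show "of_real (cmod (1 - w) powr (- s)) = (1 - w) powr of_real (- l) *
        ((1 - cnj w) powr of_real (- l) * (1 - 0 * cnj w) powr of_real (- 0))"
      by simp
  qed simp
  also have "\<dots> = of_real (1 / Beta l (2 + \<alpha> - l)) *
      (LINT t | beta_measure l (2 + \<alpha> - (l + l)). (1 - 0 * of_real t) powr of_real (- 0))"
    using \<alpha> l s by (intro integral_weighted_area_powr) (auto simp: l_def)
  also have "\<dots> = of_real (Beta l (2 + \<alpha> - s) / Beta l (2 + \<alpha> - l))"
    using l s by (simp add: measure_beta_measure l_def scaleR_conv_of_real)
  finally have "(LINT w | weighted_area \<alpha>. cmod (1 - w) powr (- s)) = Beta l (2 + \<alpha> - s) / Beta l (2 + \<alpha> - l)"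
    by (simp only: of_real_eq_iff)
  also have "\<dots> = Gamma (2 + \<alpha>) * Gamma (2 + \<alpha> - s) / (Gamma (2 + \<alpha> - l))\<^sup>2"
  proof -
    have "Gamma l > 0" "Gamma (2 + \<alpha> - l) > 0" "Gamma (2 + \<alpha>) > 0" using l \<alpha> by simp_all
    moreover have eqs: "l + (2 + \<alpha> - s) = 2 + \<alpha> - l" "l + (2 + \<alpha> - l) = 2 + \<alpha>" by (simp_all add: l_def)
    ultimately show ?thesis unfolding Beta_def eqs by (simp add: power2_eq_square)
  qed
  finally show ?thesis by (simp add: l_def)
qed

text \<open>
  Both integrals are taken against \<open>t\<^bsup>\<sigma>-1\<^esup>(1-t)\<^bsup>c-s-1\<^esup>\<close>, where the factors \<open>t\<^bsup>a-\<sigma>\<^esup>\<close> and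
  \<open>t\<^bsup>s-\<sigma>\<^esup>\<close> differ by \<open>O(1-t)\<close>. This gains one power of \<open>1-t\<close> over the main term.
\<close>

lemma bergman_projection_test_function_remainder:
  assumes \<alpha>: "\<alpha> > -1" and a: "0 < a" "a < 2 + \<alpha>" and \<sigma>: "0 < \<sigma>" "\<sigma> \<le> a" "\<sigma> \<le> s"
    and s: "s \<le> s\<^sub>0" "s < 2 + \<alpha>" and e: "s\<^sub>0 - 1 < e" "0 \<le> e" "e \<le> 2 + \<alpha>" and z: "cmod z < 1"
  shows "cmod (bergman_projection \<alpha> (test_function a s) z -
      of_real (Beta s (2 + \<alpha> - s) / Beta a (2 + \<alpha> - a)) * (1 - z) powr of_real (- s)) \<le>
    (2 + \<alpha>) * Beta \<sigma> (e + 1 - s\<^sub>0) / Beta a (2 + \<alpha> - a) * (1 - cmod z) powr (- e)"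
proof -
  define c where "c = 2 + \<alpha>"
  have c: "c > 1" "a < c" "s < c" "e \<le> c" using \<alpha> a s e by (simp_all add: c_def)
  have s0: "0 < s" using \<sigma> by simp
  define K where "K = 1 / Beta a (c - a)"
  have K: "K > 0" using a c by (simp add: K_def Beta_real_pos)
  define g where "g t = (1 - z * of_real t) powr of_real (- c)" for t
  have [measurable]: "g \<in> borel_measurable borel" unfolding g_def by measurable
  \<comment> \<open>The exponent -c is split as (e-c) + (-e), and |1 - tz| is bounded below by 1-t
    in the first part and by 1-|z| in the second. Thus \<open>e\<close> decides how much of the
    singularity is left to z.\<close>
  have g_le: "norm (g t) \<le> (1 - t) powr (e - c) * (1 - cmod z) powr (- e)" if t: "t \<in> {0<..<1}" for t
  proof -
    define v where "v = cmod (1 - z * of_real t)"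
    have v1: "1 - t \<le> v"
      using one_minus_norm_le[of "cnj z" "of_real t"] z t by (simp add: v_def mult.commute)
    have v2: "1 - cmod z \<le> v"
      using one_minus_norm_le[of "of_real t" z] t by (simp add: v_def)
    have "norm (g t) = v powr (e - c) * v powr (- e)"
      unfolding g_def norm_powr_of_real v_def powr_add[symmetric] by simp
    also have "\<dots> \<le> (1 - t) powr (e - c) * (1 - cmod z) powr (- e)"
      using v1 v2 t z e c by (intro mult_mono powr_mono2') auto
    finally show ?thesis .
  qed
  let ?B = "beta_measure \<sigma> (c - s)"
  interpret finite_measure ?B
    using \<sigma> c by (intro finite_measure_beta_measure) auto
  define k where "k x t = t powr (x - \<sigma>) *\<^sub>R g t" for x t
  have [measurable]: "k x \<in> borel_measurable borel" for x
    unfolding k_def by measurable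
  have int_k: "integrable ?B (k x)" if x: "x \<ge> \<sigma>" for x
  proof (rule integrable_const_bound)
    show "AE t in ?B. norm (k x t) \<le> (1 - cmod z) powr (- c)"
    proof (rule eventually_mono[OF AE_beta_measure])
      fix t :: real assume t: "t \<in> {0<..<1}"
      have "norm (g t) \<le> (1 - cmod z) powr (- c)"
        unfolding g_def norm_powr_of_real using one_minus_norm_le[of "of_real t" z] t z c
        by (intro powr_mono2') auto
      moreover have "t powr (x - \<sigma>) \<le> 1" using t x powr_mono'[of 0 "x - \<sigma>" t] by auto
      ultimately have "t powr (x - \<sigma>) * norm (g t) \<le> 1 * (1 - cmod z) powr (- c)"
        by (intro mult_mono) auto
      then show "norm (k x t) \<le> (1 - cmod z) powr (- c)" by (simp add: k_def)
    qed
  qed simp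
  have lint_k: "(LINT t | ?B. k x t) = (LINT t | beta_measure x (c - s). g t)" for x
    unfolding k_def by (subst integral_beta_measure_tilt_left) simp_all
  have "bergman_projection \<alpha> (test_function a s) z = of_real K * (LINT t | ?B. k a t)"
    unfolding lint_k unfolding g_def K_def c_def
    by (rule bergman_projection_test_function[OF \<alpha> a s0 s(2) z])
  moreover have "of_real (Beta s (c - s) / Beta a (c - a)) * (1 - z) powr of_real (- s) =
      of_real K * (LINT t | ?B. k s t)"
    unfolding lint_k g_def integral_beta_measure_euler[OF s0 c(3) z] K_def by simp
  ultimately have "bergman_projection \<alpha> (test_function a s) z -
      of_real (Beta s (c - s) / Beta a (c - a)) * (1 - z) powr of_real (- s) =
      of_real K * (LINT t | ?B. k a t - k s t)"
    using int_k \<sigma> by (simp add: right_diff_distrib)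
  then have eq: "cmod (bergman_projection \<alpha> (test_function a s) z -
      of_real (Beta s (c - s) / Beta a (c - a)) * (1 - z) powr of_real (- s)) =
      K * cmod (LINT t | ?B. k a t - k s t)"
    using K by (simp only: norm_mult norm_of_real abs_of_pos)
  have "cmod (LINT t | ?B. k a t - k s t) \<le> (LINT t | ?B. norm (k a t - k s t))"
    by (rule integral_norm_bound)
  also have "\<dots> \<le> (LINT t | ?B. (1 - t) powr (1 + e - c) *\<^sub>R (c * (1 - cmod z) powr (- e)))"
  proof (rule integral_mono_AE')
    \<comment> \<open>The second parameter is e+1-s, positive because s \<le>
      \<open>s\<^sub>0\<close> < e+1; the 1 is the power gained from the difference of the
      t-powers.\<close>
    have "finite_measure (beta_measure \<sigma> (c - s + (1 + e - c)))"
      using \<sigma> s e by (intro finite_measure_beta_measure) auto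
    then show "integrable ?B (\<lambda>t. (1 - t) powr (1 + e - c) *\<^sub>R (c * (1 - cmod z) powr (- e)))"
      by (subst integrable_beta_measure_tilt_right) (auto intro: finite_measure.integrable_const)
    show "AE t in ?B. norm (k a t - k s t) \<le> (1 - t) powr (1 + e - c) *\<^sub>R (c * (1 - cmod z) powr (- e))"
    proof (rule eventually_mono[OF AE_beta_measure])
      fix t :: real assume t: "t \<in> {0<..<1}"
      have "norm (k a t - k s t) = \<bar>t powr (a - \<sigma>) - t powr (s - \<sigma>)\<bar> * norm (g t)"
        unfolding k_def scaleR_diff_left[symmetric] by simp
      also have "\<dots> \<le> (c * (1 - t)) * ((1 - t) powr (e - c) * (1 - cmod z) powr (- e))"
        using t c \<sigma> by (intro mult_mono g_le abs_powr_diff_le) auto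
      also have "\<dots> = ((1 - t) powr 1 * (1 - t) powr (e - c)) * (c * (1 - cmod z) powr (- e))"
        using t by (simp add: mult_ac)
      also have "(1 - t) powr 1 * (1 - t) powr (e - c) = (1 - t) powr (1 + e - c)"
        unfolding powr_add[symmetric] by (simp add: add_diff_eq)
      finally show "norm (k a t - k s t) \<le> (1 - t) powr (1 + e - c) *\<^sub>R (c * (1 - cmod z) powr (- e))"
        by simp
    qed
    show "AE t in ?B. 0 \<le> (1 - t) powr (1 + e - c) *\<^sub>R (c * (1 - cmod z) powr (- e))"
      using c by (intro AE_I2) simp
  qed
  also have "\<dots> = Beta \<sigma> (e + 1 - s) * (c * (1 - cmod z) powr (- e))"
  proof -
    have eq: "c - s + (1 + e - c) = e + 1 - s" by simp
    show ?thesis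
      unfolding integral_beta_measure_tilt_right[OF borel_measurable_const] eq
      using \<sigma> s e by (simp add: measure_beta_measure)
  qed
  \<comment> \<open>Beta decreases in its arguments, so moving from s to \<open>s\<^sub>0\<close>
    makes the bound uniform in s.\<close>
  also have "\<dots> \<le> Beta \<sigma> (e + 1 - s\<^sub>0) * (c * (1 - cmod z) powr (- e))"
    using \<sigma> s e c by (intro mult_right_mono Beta_real_mono) auto
  finally have "K * cmod (LINT t | ?B. k a t - k s t) \<le>
      K * (Beta \<sigma> (e + 1 - s\<^sub>0) * (c * (1 - cmod z) powr (- e)))"
    using K by (intro mult_left_mono) auto
  then show ?thesis
    unfolding eq[symmetric] by (simp add: c_def K_def mult_ac)
qed

text \<open>Since 1-|z| is at least (1-|z|^2)/2, the integrand is dominated by a function of |z|^2,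
  to which the radial reduction applies. This puts the remainder bound into L^p.\<close>

lemma nn_integral_one_minus_norm_powr_finite:
  assumes \<alpha>: "\<alpha> > -1" and d: "0 \<le> d" "d < 1 + \<alpha>"
  shows "(\<integral>\<^sup>+ z. ennreal ((1 - cmod z) powr (- d)) \<partial>weighted_area \<alpha>) < \<infinity>"
proof -
  have "(\<integral>\<^sup>+ z. ennreal ((1 - cmod z) powr (- d)) \<partial>weighted_area \<alpha>) \<le>
      (\<integral>\<^sup>+ z. ennreal (((1 - (cmod z)\<^sup>2) / 2) powr (- d)) \<partial>weighted_area \<alpha>)"
  proof (intro nn_integral_mono ennreal_leI powr_mono2')
    fix z assume "z \<in> space (weighted_area \<alpha>)"
    then have z: "cmod z < 1" by simp
    then show "(1 - (cmod z)\<^sup>2) / 2 > 0" by (simp add: power_less_one_iff abs_square_less_1)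
    have "0 \<le> (1 - cmod z)\<^sup>2" by simp
    then show "(1 - (cmod z)\<^sup>2) / 2 \<le> 1 - cmod z"
      unfolding power2_diff by (simp add: power2_eq_square)
  qed (use d in simp)
  also have "\<dots> = ennreal (1 + \<alpha>) * (\<integral>\<^sup>+ x. ennreal (((1 - x) / 2) powr (- d)) \<partial>beta_measure 1 (1 + \<alpha>))"
    using \<alpha> by (intro nn_integral_weighted_area_radial) auto
  also have "\<dots> < \<infinity>"
  proof -
    have "finite_measure (beta_measure 1 (1 + \<alpha> + - d))"
      using d by (intro finite_measure_beta_measure) auto
    then have "integrable (beta_measure 1 (1 + \<alpha>)) (\<lambda>x. (1 - x) powr (- d) *\<^sub>R (2 powr d))"
      by (subst integrable_beta_measure_tilt_right) (auto intro: finite_measure.integrable_const)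
    then have "integrable (beta_measure 1 (1 + \<alpha>)) (\<lambda>x. ((1 - x) / 2) powr (- d))"
    proof (rule integrable_cong_AE_imp)
      show "AE x in beta_measure 1 (1 + \<alpha>). (1 - x) powr (- d) *\<^sub>R (2 powr d) = ((1 - x) / 2) powr (- d)"
        by (rule eventually_mono[OF AE_beta_measure]) (simp add: powr_divide powr_minus field_simps)
    qed measurable
    then have "(\<integral>\<^sup>+ x. ennreal (norm (((1 - x) / 2) powr (- d))) \<partial>beta_measure 1 (1 + \<alpha>)) < \<infinity>"
      by (simp only: integrable_iff_bounded)
    then show ?thesis by (simp add: ennreal_mult_less_top)
  qed
  finally show ?thesis .
qed

text \<open>Turns the supremum, at one function, into an inequality between integrals of p-th
  powers. An infinite left integral would make the quotient infinite, contradicting the finite bound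
  \<open>N\<close>.\<close>

lemma nn_integral_bergman_projection_le_norm:
  assumes p: "p > 1" and N: "N \<ge> 0" "bergman_projection_norm p \<alpha> \<le> ennreal N"
    and f: "f \<in> borel_measurable (lebesgue_on unit_disk)"
    and U: "U > 0" "(\<integral>\<^sup>+ z. ennreal (cmod (f z) powr p) \<partial>weighted_area \<alpha>) = ennreal U"
  shows "(\<integral>\<^sup>+ z. ennreal (cmod (bergman_projection \<alpha> f z) powr p) \<partial>weighted_area \<alpha>) \<le> ennreal (N powr p * U)"
proof -
  define J where "J = (\<integral>\<^sup>+ z. ennreal (cmod (bergman_projection \<alpha> f z) powr p) \<partial>weighted_area \<alpha>)"
  have norm_f: "bergman_norm p \<alpha> f = ennreal (U powr (1 / p))"
    using U by (simp add: bergman_norm_def)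
  have "\<not> (AE z in weighted_area \<alpha>. f z = 0)"
  proof
    assume "AE z in weighted_area \<alpha>. f z = 0"
    then have "(\<integral>\<^sup>+ z. ennreal (cmod (f z) powr p) \<partial>weighted_area \<alpha>) = (\<integral>\<^sup>+ z. 0 \<partial>weighted_area \<alpha>)"
      using p by (intro nn_integral_cong_AE) (auto elim!: eventually_mono)
    with U show False by simp
  qed
  moreover have "f \<in> weighted_Lp p \<alpha>"
    using f by (simp add: weighted_Lp_def norm_f)
  ultimately have "bergman_norm p \<alpha> (bergman_projection \<alpha> f) / bergman_norm p \<alpha> f \<le> bergman_projection_norm p \<alpha>"
    unfolding bergman_projection_norm_def by (intro SUP_upper) simp
  then have le: "bergman_norm p \<alpha> (bergman_projection \<alpha> f) / ennreal (U powr (1 / p)) \<le> ennreal N"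
    using N norm_f by simp
  have J_fin: "J \<noteq> \<infinity>"
  proof
    assume "J = \<infinity>"
    then have "bergman_norm p \<alpha> (bergman_projection \<alpha> f) = \<infinity>"
      by (simp add: bergman_norm_def J_def[symmetric])
    with le U show False by (simp add: ennreal_top_divide top_unique)
  qed
  then obtain j where j: "j \<ge> 0" "J = ennreal j" by (cases J) auto
  have "bergman_norm p \<alpha> (bergman_projection \<alpha> f) = ennreal (j powr (1 / p))"
    using j by (simp add: bergman_norm_def J_def[symmetric])
  with le U N have "j powr (1 / p) / U powr (1 / p) \<le> N"
    by (simp add: divide_ennreal)
  then have "j powr (1 / p) \<le> N * U powr (1 / p)"
    using U by (simp add: divide_le_eq)
  then have "(j powr (1 / p)) powr p \<le> (N * U powr (1 / p)) powr p"
    using p by (intro powr_mono2) auto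
  then have "j \<le> N powr p * U"
    using j U N p by (simp add: powr_powr powr_mult)
  then show ?thesis using j by (simp add: J_def[symmetric] ennreal_leI)
qed

lemma bergman_projection_norm_ge:
  fixes \<alpha> p q :: real
  assumes \<alpha>: "\<alpha> > -1" and p: "p > 1" and q: "q = p / (p - 1)"
  shows "ennreal (Gamma ((2 + \<alpha>) / p) * Gamma ((2 + \<alpha>) / q) / (Gamma ((2 + \<alpha>) / 2))\<^sup>2) \<le>
    bergman_projection_norm p \<alpha>"
proof -
  define c where "c = 2 + \<alpha>"
  have c: "c > 1" using \<alpha> by (simp add: c_def)
  define a where "a = c / 2"
  define s\<^sub>0 where "s\<^sub>0 = c / p"
  have s\<^sub>0: "0 < s\<^sub>0" "s\<^sub>0 < c" "s\<^sub>0 * p = c" using c p by (auto simp: s\<^sub>0_def divide_less_eq)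
  have "c - s\<^sub>0 = c * (1 - 1 / p)" by (simp add: s\<^sub>0_def right_diff_distrib)
  also have "1 - 1 / p = 1 / q" using conjugate_exponent(2)[OF p q] by linarith
  finally have cq: "c / q = c - s\<^sub>0" by simp
  \<comment> \<open>The exponent e has to exceed \<open>s\<^sub>0 - 1\<close> for the remainder
    estimate, and ep has to stay below c - 1 = 1+\<alpha> for integrability. There is room because
    c/p - 1 < (c-1)/p when p > 1.\<close>
  have "max 0 (s\<^sub>0 - 1) < (c - 1) / p"
    using c p divide_strict_right_mono[of 1 c p] by (simp add: s\<^sub>0_def diff_divide_distrib)
  then obtain e where e: "max 0 (s\<^sub>0 - 1) < e" "e < (c - 1) / p" using dense by blast
  have ep: "e * p < c - 1" using e p by (simp add: less_divide_eq)
  have ec: "e \<le> c"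
  proof -
    have "e * 1 \<le> e * p" using e p by (intro mult_left_mono) auto
    with ep show ?thesis by simp
  qed
  \<comment> \<open>Below \<open>a\<close> and below every s in the range considered, so a single
    remainder constant serves them all.\<close>
  define \<sigma> where "\<sigma> = min a (s\<^sub>0 / 2)"
  have \<sigma>: "0 < \<sigma>" "\<sigma> \<le> a" "\<sigma> \<le> s\<^sub>0 / 2" using c s\<^sub>0 by (auto simp: \<sigma>_def a_def)
  define M where "M = c * Beta \<sigma> (e + 1 - s\<^sub>0) / Beta a (c - a)"
  have M: "M > 0"
    using c \<sigma> e unfolding M_def by (intro divide_pos_pos mult_pos_pos Beta_real_pos) (auto simp: a_def)
  define C where "C s = Gamma s * Gamma (c - s) / (Gamma a)\<^sup>2" for s
  have C_pos: "C s > 0" if "0 < s" "s < c" for s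
    using that c unfolding C_def by (intro divide_pos_pos mult_pos_pos zero_less_power Gamma_real_pos) (auto simp: a_def)
  have C_Beta: "C s = Beta s (c - s) / Beta a (c - a)" for s
  proof -
    have "c - a = a" by (simp add: a_def)
    moreover have "Gamma c > 0" using c by simp
    ultimately show ?thesis by (simp add: C_def Beta_def power2_eq_square a_def)
  qed
  \<comment> \<open>The reciprocal of the integral of |f|^p. Writing 1/\<Gamma>(x) as
    x/\<Gamma>(x+1) with x = c - sp makes it continuous at \<open>s\<^sub>0\<close>, where x and
    hence \<open>V\<close> vanish.\<close>
  define V where "V s = (Gamma (c - s * p / 2))\<^sup>2 * (c - s * p) / (Gamma c * Gamma (c - s * p + 1))" for s
  define E where "E = enn2real (\<integral>\<^sup>+ z. ennreal ((1 - cmod z) powr (- (e * p))) \<partial>weighted_area \<alpha>)"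
  have "(\<integral>\<^sup>+ z. ennreal ((1 - cmod z) powr (- (e * p))) \<partial>weighted_area \<alpha>) < \<infinity>"
    using \<alpha> e ep p by (intro nn_integral_one_minus_norm_powr_finite) (auto simp: c_def)
  then have E: "(\<integral>\<^sup>+ z. ennreal ((1 - cmod z) powr (- (e * p))) \<partial>weighted_area \<alpha>) = ennreal E" "E \<ge> 0"
    by (auto simp: E_def)
  \<comment> \<open>Finiteness of the norm comes from the upper bound already proved.\<close>
  obtain N where N: "N \<ge> 0" "bergman_projection_norm p \<alpha> = ennreal N"
    using bergman_projection_norm_le[OF \<alpha> p q] by (cases "bergman_projection_norm p \<alpha>") (auto simp: top_unique)
  \<comment> \<open>The pointwise inequality, integrated and divided by the integral of |f|^p, so
    that the remainder is multiplied by \<open>V s\<close>.\<close>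
  have key: "C s powr p \<le> (1 - \<epsilon>) powr (1 - p) * N powr p + \<epsilon> powr (1 - p) * M powr p * E * V s"
    if s: "s\<^sub>0 / 2 \<le> s" "s < s\<^sub>0" and \<epsilon>: "0 < \<epsilon>" "\<epsilon> < 1" for s \<epsilon>
  proof -
    have sc: "0 < s" "s < c" using s s\<^sub>0 by auto
    have sp: "0 < s * p" "s * p < c"
      using sc p mult_strict_right_mono[OF s(2), of p] s\<^sub>0(3) by auto
    define U where "U = (LINT w | weighted_area \<alpha>. cmod (1 - w) powr (- (s * p)))"
    have U_eq: "U = Gamma c * Gamma (c - s * p) / (Gamma (c - s * p / 2))\<^sup>2"
      unfolding U_def c_def using \<alpha> sp by (intro integral_norm_one_minus_powr) (auto simp: c_def)
    have G_pos: "Gamma c > 0" "Gamma (c - s * p) > 0" "Gamma (c - s * p / 2) > 0"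
      using c sp by simp_all
    have U_pos: "U > 0"
      unfolding U_eq using G_pos by (intro divide_pos_pos mult_pos_pos zero_less_power)
    have V_eq: "V s = 1 / U"
    proof -
      have "Gamma (c - s * p + 1) = (c - s * p) * Gamma (c - s * p)"
        using sp by (intro Gamma_plus1 pos_not_nonpos_Ints) simp
      then show ?thesis unfolding V_def U_eq using G_pos sp by simp
    qed
    have nn_U: "(\<integral>\<^sup>+ w. ennreal (cmod (1 - w) powr (- (s * p))) \<partial>weighted_area \<alpha>) = ennreal U"
      unfolding U_def using \<alpha> sp
      by (intro nn_integral_eq_integral integrable_norm_one_minus_powr) (auto simp: c_def)
    define f where "f = test_function a s"
    have f: "f \<in> borel_measurable (lebesgue_on unit_disk)"
      unfolding f_def by (intro borel_measurable_lebesgue_on_disk) simp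
    have "(\<integral>\<^sup>+ z. ennreal (cmod (f z) powr p) \<partial>weighted_area \<alpha>) = ennreal U"
      using nn_U by (simp add: f_def norm_test_function powr_powr)
    with p N f U_pos have Pf_le: "(\<integral>\<^sup>+ z. ennreal (cmod (bergman_projection \<alpha> f z) powr p) \<partial>weighted_area \<alpha>) \<le>
        ennreal (N powr p * U)"
      by (intro nn_integral_bergman_projection_le_norm) auto
    \<comment> \<open>A visibly Borel minorant of the p-th power of the projection. The integral of
      a sum is split with \<open>G\<close>, and monotonicity alone then brings in the
      projection.\<close>
    define G where "G z = (1 - \<epsilon>) powr (p - 1) *
        max 0 (C s powr p * cmod (1 - z) powr (- (s * p)) - \<epsilon> powr (1 - p) * M powr p * (1 - cmod z) powr (- (e * p)))" for z
    have [measurable]: "G \<in> borel_measurable borel" unfolding G_def by measurable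
    have G0: "G z \<ge> 0" for z by (simp add: G_def)
    have cancel: "(1 - \<epsilon>) powr (1 - p) * (1 - \<epsilon>) powr (p - 1) = 1"
      using \<epsilon> by (simp add: powr_add[symmetric])
    have G_le: "G z \<le> cmod (bergman_projection \<alpha> f z) powr p" if z: "cmod z < 1" for z
    proof -
      define x where "x = cmod (bergman_projection \<alpha> f z)"
      define y where "y = M * (1 - cmod z) powr (- e)"
      have y: "y > 0" using M z by (simp add: y_def)
      have "cmod (bergman_projection \<alpha> f z - of_real (C s) * (1 - z) powr of_real (- s)) \<le> y"
        unfolding f_def C_Beta y_def M_def c_def
        by (rule bergman_projection_test_function_remainder)
           (use \<alpha> c \<sigma> s s\<^sub>0 sc e ec z in \<open>auto simp: c_def a_def\<close>)
      then have "cmod (of_real (C s) * (1 - z) powr of_real (- s)) \<le> x + y"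
        unfolding x_def using norm_triangle_ineq2[of "of_real (C s) * (1 - z) powr of_real (- s)" "bergman_projection \<alpha> f z"]
        by (simp add: norm_minus_commute)
      then have "C s * cmod (1 - z) powr (- s) \<le> x + y"
        using C_pos[OF sc] unfolding norm_mult norm_powr_of_real norm_of_real by simp
      then have "(C s * cmod (1 - z) powr (- s)) powr p \<le> (x + y) powr p"
        using p C_pos[OF sc] by (intro powr_mono2) auto
      also have "\<dots> \<le> (1 - \<epsilon>) powr (1 - p) * x powr p + \<epsilon> powr (1 - p) * y powr p"
        using p \<epsilon> y by (intro powr_add_le) (auto simp: x_def)
      also have "y powr p = M powr p * (1 - cmod z) powr (- (e * p))"
        using M by (simp add: y_def powr_mult powr_powr)
      also have "(C s * cmod (1 - z) powr (- s)) powr p = C s powr p * cmod (1 - z) powr (- (s * p))"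
        using C_pos[OF sc] by (simp add: powr_mult powr_powr)
      finally have "max 0 (C s powr p * cmod (1 - z) powr (- (s * p)) - \<epsilon> powr (1 - p) * M powr p * (1 - cmod z) powr (- (e * p)))
          \<le> (1 - \<epsilon>) powr (1 - p) * x powr p"
        by (simp add: mult.assoc)
      then have "G z \<le> (1 - \<epsilon>) powr (p - 1) * ((1 - \<epsilon>) powr (1 - p) * x powr p)"
        unfolding G_def by (rule mult_left_mono) simp
      also have "\<dots> = x powr p"
        using cancel by (simp add: mult_ac flip: mult.assoc)
      finally show ?thesis by (simp add: x_def)
    qed
    have "ennreal (C s powr p * U) =
        (\<integral>\<^sup>+ z. ennreal (C s powr p) * ennreal (cmod (1 - z) powr (- (s * p))) \<partial>weighted_area \<alpha>)"
      using nn_U by (subst nn_integral_cmult) (auto simp: ennreal_mult')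
    also have "\<dots> \<le> (\<integral>\<^sup>+ z. ennreal ((1 - \<epsilon>) powr (1 - p)) * ennreal (G z) +
        ennreal (\<epsilon> powr (1 - p) * M powr p) * ennreal ((1 - cmod z) powr (- (e * p))) \<partial>weighted_area \<alpha>)"
    proof (rule nn_integral_mono)
      fix z
      define A where "A = C s powr p * cmod (1 - z) powr (- (s * p))"
      define B where "B = \<epsilon> powr (1 - p) * M powr p * (1 - cmod z) powr (- (e * p))"
      have B: "B \<ge> 0" by (simp add: B_def)
      have "(1 - \<epsilon>) powr (1 - p) * G z = max 0 (A - B)"
        using cancel by (simp add: G_def A_def B_def flip: mult.assoc)
      then have "A \<le> (1 - \<epsilon>) powr (1 - p) * G z + B" by simp
      then have "ennreal A \<le> ennreal ((1 - \<epsilon>) powr (1 - p) * G z + B)" by (rule ennreal_leI)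
      also have "\<dots> = ennreal ((1 - \<epsilon>) powr (1 - p) * G z) + ennreal B"
        using G0[of z] B by (intro ennreal_plus) auto
      finally show "ennreal (C s powr p) * ennreal (cmod (1 - z) powr (- (s * p))) \<le>
          ennreal ((1 - \<epsilon>) powr (1 - p)) * ennreal (G z) +
          ennreal (\<epsilon> powr (1 - p) * M powr p) * ennreal ((1 - cmod z) powr (- (e * p)))"
        by (simp add: A_def B_def ennreal_mult'[symmetric])
    qed
    also have "\<dots> = ennreal ((1 - \<epsilon>) powr (1 - p)) * (\<integral>\<^sup>+ z. ennreal (G z) \<partial>weighted_area \<alpha>) +
        ennreal (\<epsilon> powr (1 - p) * M powr p) * ennreal E"
      unfolding E(1)[symmetric] by (subst nn_integral_add) (auto simp: nn_integral_cmult)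
    also have "\<dots> \<le> ennreal ((1 - \<epsilon>) powr (1 - p)) * ennreal (N powr p * U) +
        ennreal (\<epsilon> powr (1 - p) * M powr p) * ennreal E"
    proof (intro add_right_mono mult_left_mono order.trans[OF _ Pf_le] nn_integral_mono ennreal_leI G_le)
      show "cmod z < 1" if "z \<in> space (weighted_area \<alpha>)" for z using that by simp
    qed simp
    also have "\<dots> = ennreal ((1 - \<epsilon>) powr (1 - p) * (N powr p * U) + \<epsilon> powr (1 - p) * M powr p * E)"
      using E(2) U_pos by (simp add: ennreal_mult'[symmetric] ennreal_plus[symmetric] del: ennreal_plus)
    finally have "C s powr p * U \<le> (1 - \<epsilon>) powr (1 - p) * (N powr p * U) + \<epsilon> powr (1 - p) * M powr p * E"
      using E(2) U_pos by (subst (asm) ennreal_le_iff) auto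
    then show ?thesis
      unfolding V_eq using U_pos by (simp add: field_simps)
  qed
  have C_tendsto: "((\<lambda>s. C s powr p) \<longlongrightarrow> C s\<^sub>0 powr p) (at_left s\<^sub>0)"
    unfolding C_def using s\<^sub>0 c p
    by (intro tendsto_intros) (auto simp: a_def Gamma_eq_zero_iff intro!: pos_not_nonpos_Ints)
  have V_tendsto: "(V \<longlongrightarrow> 0) (at_left s\<^sub>0)"
  proof -
    have "(V \<longlongrightarrow> (Gamma (c - s\<^sub>0 * p / 2))\<^sup>2 * (c - s\<^sub>0 * p) / (Gamma c * Gamma (c - s\<^sub>0 * p + 1))) (at_left s\<^sub>0)"
      unfolding V_def using s\<^sub>0 c
      by (intro tendsto_intros) (auto simp: Gamma_eq_zero_iff intro!: pos_not_nonpos_Ints)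
    then show ?thesis by (simp add: s\<^sub>0)
  qed
  \<comment> \<open>The order of limits matters: \<epsilon> stays fixed while s \<rightarrow>
    \<open>s\<^sub>0\<close>, so that \<open>V s\<close> removes the remainder before its factor
    \<epsilon>^(1-p) can grow.\<close>
  have ineq: "C s\<^sub>0 powr p \<le> (1 - \<epsilon>) powr (1 - p) * N powr p" if \<epsilon>: "0 < \<epsilon>" "\<epsilon> < 1" for \<epsilon>
  proof (rule tendsto_le[OF _ _ C_tendsto])
    have "((\<lambda>s. (1 - \<epsilon>) powr (1 - p) * N powr p + \<epsilon> powr (1 - p) * M powr p * E * V s) \<longlongrightarrow>
        (1 - \<epsilon>) powr (1 - p) * N powr p + \<epsilon> powr (1 - p) * M powr p * E * 0) (at_left s\<^sub>0)"
      by (intro tendsto_intros V_tendsto)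
    then show "((\<lambda>s. (1 - \<epsilon>) powr (1 - p) * N powr p + \<epsilon> powr (1 - p) * M powr p * E * V s) \<longlongrightarrow>
        (1 - \<epsilon>) powr (1 - p) * N powr p) (at_left s\<^sub>0)" by simp
    have "eventually (\<lambda>s. s \<in> {s\<^sub>0 / 2<..<s\<^sub>0}) (at_left s\<^sub>0)"
      using s\<^sub>0 by (intro eventually_at_left_real) simp
    then show "eventually (\<lambda>s. C s powr p \<le> (1 - \<epsilon>) powr (1 - p) * N powr p +
        \<epsilon> powr (1 - p) * M powr p * E * V s) (at_left s\<^sub>0)"
      by eventually_elim (intro key \<epsilon>; simp)
  qed simp
  have "C s\<^sub>0 powr p \<le> N powr p"
  proof (rule tendsto_lowerbound)
    have "((\<lambda>\<epsilon>. (1 - \<epsilon>) powr (1 - p) * N powr p) \<longlongrightarrow> (1 - 0) powr (1 - p) * N powr p) (at_right 0)"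
      by (intro tendsto_intros) auto
    then show "((\<lambda>\<epsilon>. (1 - \<epsilon>) powr (1 - p) * N powr p) \<longlongrightarrow> N powr p) (at_right 0)" by simp
    have "eventually (\<lambda>\<epsilon>. \<epsilon> \<in> {0<..<1}) (at_right (0::real))"
      by (rule eventually_at_right_real) simp
    then show "eventually (\<lambda>\<epsilon>. C s\<^sub>0 powr p \<le> (1 - \<epsilon>) powr (1 - p) * N powr p) (at_right 0)"
      by eventually_elim (intro ineq; simp)
  qed simp
  then have "C s\<^sub>0 \<le> N"
    using p N C_pos[OF s\<^sub>0(1,2)] powr_less_mono2[of p N "C s\<^sub>0"] by force
  then show ?thesis
    using N cq by (simp add: C_def a_def s\<^sub>0_def c_def ennreal_leI)
qed

theorem theorem1p1:
  fixes \<alpha> p q :: real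
  assumes "\<alpha> > -1" and "1 < p" and "q = p / (p - 1)"
  shows "ennreal (Gamma ((2 + \<alpha>) / p) * Gamma ((2 + \<alpha>) / q) / (Gamma ((2 + \<alpha>) / 2))\<^sup>2)
           \<le> bergman_projection_norm p \<alpha>
       \<and> bergman_projection_norm p \<alpha>
           \<le> ennreal ((1 + \<alpha>) *
               (Gamma ((1 + \<alpha>) / p) * Gamma ((1 + \<alpha>) / q) / (Gamma ((2 + \<alpha>) / 2))\<^sup>2))"
  using bergman_projection_norm_ge[OF assms] bergman_projection_norm_le[OF assms] by blast

end
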